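(* Let $L$ be a number field with ring of integers $\mathcal{O}_L$, let $n\geq 2$ be an integer, and let $\alpha\in\mathcal{O}_L$ be such that $x^n-\alpha$ is irreducible over $L$. Let $\sqrt[n]{\alpha}$ be a root of $x^n-\alpha$. For each prime $\mathfrak{p}$ of $\mathcal{O}_L$ dividing $n$, let $p$ be its residue characteristic and $f$ its residue class degree, write $n=p^e m$ with $\gcd(m,p)=1$, and let $\varepsilon$ be the integer with $\varepsilon\equiv e \pmod f$ and $1\leq\varepsilon\leq f$. Then the ring of integers of $L(\sqrt[n]{\alpha})$ is $\mathcal{O}_L[\sqrt[n]{\alpha}]$ if and only if $\alpha$ is square-free as an ideal of $\mathcal{O}_L$ and every prime $\mathfrak{p}$ of $\mathcal{O}_L$ dividing $n$ fails to satisfy the congruence $$\alpha^{p^{f-\varepsilon+e}}\equiv\alpha \pmod{\mathfrak{p}^2}.$$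
   Context: "$\alpha$ is square-free as an ideal" means that the principal ideal $(\alpha)$ is not divisible by the square of any prime ideal; the unit ideal counts as square-free. The quantities $p,f,e,m,\varepsilon$ depend on the prime $\mathfrak{p}$. *)

theory Defs
  imports
    "HOL-Algebra.Algebra"
    "HOL-Algebra.Algebraic_Closure_Type"
    "HOL-Number_Theory.Cong"
begin

text \<open>
  A number field is a type of class \<^class>\<open>field_char_0\<close> that is finite-dimensional over the
  rationals. An extension of it inside a further such type is given by a field embedding.
  Ideals and residue rings are those of HOL-Algebra, taken in the ring of integers.
\<close>

definition number_field :: "'a::field_char_0 itself \<Rightarrow> bool" where
  "number_field (_ :: 'a itself) \<longleftrightarrow>
     (\<exists>B :: 'a set. finite_dimensional_vector_space (\<lambda>q x. of_rat q * x) B)"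

definition integers_of :: "'a::field_char_0 set \<Rightarrow> 'a set" where
  "integers_of F = {x \<in> F. algebraic_int x}"

definition ring_of_integers :: "'a::field_char_0 ring" where
  "ring_of_integers = ring_of_type_algebra\<lparr>carrier := integers_of UNIV\<rparr>"

definition ideal_divides :: "'a::field_char_0 set \<Rightarrow> 'a set \<Rightarrow> bool" where
  "ideal_divides I J \<longleftrightarrow> (\<exists>C. ideal C ring_of_integers \<and> J = I \<cdot>\<^bsub>ring_of_integers\<^esub> C)"

text \<open>As usual for rings of integers, the zero ideal does not count as a prime.\<close>

definition prime_of_integers :: "'a::field_char_0 set \<Rightarrow> bool" where
  "prime_of_integers P \<longleftrightarrow> primeideal P ring_of_integers \<and> P \<noteq> {0}"

definition ideal_square :: "'a::field_char_0 set \<Rightarrow> 'a set" where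
  "ideal_square P = P \<cdot>\<^bsub>ring_of_integers\<^esub> P"

definition squarefree_as_ideal :: "'a::field_char_0 \<Rightarrow> bool" where
  "squarefree_as_ideal a \<longleftrightarrow>
     (\<forall>P. prime_of_integers P \<longrightarrow> \<not> ideal_divides (ideal_square P) (PIdl\<^bsub>ring_of_integers\<^esub> a))"

definition residue_field :: "'a::field_char_0 set \<Rightarrow> 'a set ring" where
  "residue_field P = ring_of_integers Quot P"

text \<open>The characteristic is the additive order of the unit element.\<close>

definition residue_char :: "'a::field_char_0 set \<Rightarrow> nat" where
  "residue_char P = group.ord (add_monoid (residue_field P)) \<one>\<^bsub>residue_field P\<^esub>"

text \<open>The field generated by the empty set is the prime field.\<close>

definition residue_degree :: "'a::field_char_0 set \<Rightarrow> nat" where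
  "residue_degree P =
     ring.dim (residue_field P) (generate_field (residue_field P) {}) (carrier (residue_field P))"

text \<open>
  For an embedding \<open>\<phi>\<close> of \<open>L\<close> and an element \<open>b\<close> of the target field, these are
  \<open>L(b)\<close> and \<open>\<O>\<^sub>L[b]\<close>, with \<open>L\<close> identified with its image under \<open>\<phi>\<close>.
\<close>

definition adjoin_field :: "('l::field_char_0 \<Rightarrow> 'k::field_char_0) \<Rightarrow> 'k \<Rightarrow> 'k set" where
  "adjoin_field \<phi> b = generate_field ring_of_type_algebra (insert b (range \<phi>))"

definition adjoin_integers :: "('l::field_char_0 \<Rightarrow> 'k::field_char_0) \<Rightarrow> 'k \<Rightarrow> 'k set" where
  "adjoin_integers \<phi> b = generate_ring ring_of_type_algebra (insert b (\<phi> ` integers_of UNIV))"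

end

theory Submission
  imports "Jordan_Normal_Form.Char_Poly" "HOL-Number_Theory.Residues" Defs
begin

text \<open>
  Let \<open>\<O>\<close> be the ring of integers of \<open>L\<close> and \<open>R = \<O>[\<beta>]\<close>. A nonzero prime \<open>P\<close> of \<open>\<O>\<close> admits \<open>\<gamma> \<in> L\<close> and
  \<open>t \<in> P\<close> with \<open>\<gamma>P \<subseteq> \<O>\<close> and \<open>\<gamma>t \<equiv> 1\<close> modulo \<open>P\<close>, so that \<open>P\<close> consists of the \<open>a \<in> \<O>\<close> with \<open>\<gamma>a \<in> \<O>\<close>, and \<open>R\<close>
  is integrally closed iff for every \<open>P\<close> and \<open>x \<in> R\<close>, integrality of \<open>\<gamma>x\<close> implies \<open>\<gamma>x \<in> R\<close>.

  Fix \<open>P\<close> over \<open>p\<close>, write \<open>n = qm\<close> with \<open>q = p\<^sup>e\<close>, and choose \<open>a \<in> \<O>\<close> with \<open>a\<^sup>q \<equiv> \<alpha>\<close> modulo \<open>P\<close>. Expanding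
  \<open>\<alpha> = (\<eta> + a)\<^sup>q\<close> for \<open>\<eta> = \<beta>\<^sup>m - a\<close> gives a Dedekind-style relation \<open>\<eta>\<^sup>q = - \<eta>G - c\<close> with \<open>G \<in> PR\<close> and
  \<open>c = a\<^sup>q - \<alpha> \<in> P\<close>; if \<open>\<alpha> \<in> P\<close>, the relation \<open>\<beta>\<^sup>n = \<alpha>\<close> is of the same shape. If \<open>c \<in> P\<^sup>2\<close>, then
  \<open>w = \<gamma>\<eta>\<^bsup>q-1\<^esup>\<close> satisfies \<open>w\<^sup>2 = - \<gamma>Gw - \<gamma>\<^sup>2c\<eta>\<^bsup>q-2\<^esup>\<close>, so it is integral, but it is not in \<open>R\<close>. If
  \<open>c \<notin> P\<^sup>2\<close>, then \<open>R\<close> is maximal at \<open>P\<close> because \<open>R / (\<eta>R + PR)\<close> is reduced: some power \<open>u \<mapsto> u\<^sup>r\<close> of the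
  Frobenius map is the identity on it.
\<close>

section \<open>Algebraic integers form an integrally closed ring\<close>

text \<open>An infinite \<open>sum\<close> is 0, so only for finite \<open>G\<close> is this the
  additive group generated by \<open>G\<close>.\<close>

definition zspan :: "'a::field_char_0 set \<Rightarrow> 'a set" where
  "zspan G = {(\<Sum>g\<in>G. of_int (c g) * g) | c :: 'a \<Rightarrow> int. True}"

lemma zspanI: "x = (\<Sum>g\<in>G. of_int (c g) * g) \<Longrightarrow> x \<in> zspan G"
  unfolding zspan_def by blast

lemma zspan_add: assumes "x \<in> zspan G" "y \<in> zspan G" shows "x + y \<in> zspan G"
proof -
  obtain c d where "x = (\<Sum>g\<in>G. of_int (c g) * g)" "y = (\<Sum>g\<in>G. of_int (d g) * g)"
    using assms unfolding zspan_def by blast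
  then show ?thesis
    by (intro zspanI[of _ "\<lambda>g. c g + d g"]) (simp add: sum.distrib algebra_simps)
qed

lemma zspan_of_int_mult: assumes "x \<in> zspan G" shows "of_int k * x \<in> zspan G"
proof -
  obtain c where "x = (\<Sum>g\<in>G. of_int (c g) * g)"
    using assms unfolding zspan_def by blast
  then show ?thesis
    by (intro zspanI[of _ "\<lambda>g. k * c g"]) (simp add: sum_distrib_left algebra_simps)
qed

lemma zspan_zero: "0 \<in> zspan G"
  by (rule zspanI[of _ "\<lambda>_. 0"]) simp

lemma zspan_sum: "(\<And>i. i \<in> A \<Longrightarrow> h i \<in> zspan G) \<Longrightarrow> sum h A \<in> zspan G"
  by (induction A rule: infinite_finite_induct) (auto intro: zspan_zero zspan_add)

lemma zspan_base: assumes "finite G" "g \<in> G" shows "g \<in> zspan G"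
  by (rule zspanI[of _ "\<lambda>x. if x = g then 1 else 0"])
    (use assms in \<open>simp add: if_distrib[of of_int] if_distrib[of "\<lambda>z. z * _"] cong: if_cong\<close>)

lemma zspan_mult:
  assumes "\<And>g h. g \<in> G \<Longrightarrow> h \<in> H \<Longrightarrow> g * h \<in> zspan K" "x \<in> zspan G" "y \<in> zspan H"
  shows "x * y \<in> zspan K"
proof -
  obtain c d where x: "x = (\<Sum>g\<in>G. of_int (c g) * g)" and y: "y = (\<Sum>g\<in>H. of_int (d g) * g)"
    using assms(2,3) unfolding zspan_def by blast
  have "x * y = (\<Sum>g\<in>G. \<Sum>h\<in>H. of_int (c g * d h) * (g * h))"
    unfolding x y by (simp add: sum_product algebra_simps)
  also have "\<dots> \<in> zspan K"
    by (intro zspan_sum zspan_of_int_mult assms(1))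
  finally show ?thesis .
qed

text \<open>Rings that are finitely generated as abelian groups. Lying in one of them is the
  criterion through which integrality is handled; closure under addition comes from
  \<open>zspan\<close>.\<close>

definition finite_subring :: "'a::field_char_0 set \<Rightarrow> bool" where
  "finite_subring S \<longleftrightarrow>
     1 \<in> S \<and> (\<forall>x\<in>S. \<forall>y\<in>S. x * y \<in> S) \<and> (\<exists>G. finite G \<and> S = zspan G)"

text \<open>Determinant trick: multiplication by \<open>y\<close> acts on the generators through an
  integer matrix \<open>M\<close>, and the vector of generators is an eigenvector with eigenvalue
  \<open>y\<close>. So \<open>y\<close> is a root of the characteristic polynomial of
  \<open>M\<close>, which is monic and integral.\<close>

lemma finite_subring_algebraic_int:
  fixes y :: "'a::field_char_0"
  assumes "finite_subring S" "y \<in> S"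
  shows "algebraic_int y"
proof -
  obtain G where G: "finite G" "S = zspan G" and one: "1 \<in> S" and mul: "\<forall>x\<in>S. \<forall>y\<in>S. x * y \<in> S"
    using assms(1) unfolding finite_subring_def by blast
  obtain v where v: "bij_betw v {0..<card G} G"
    using ex_bij_betw_nat_finite[OF G(1)] by blast
  define k where "k = card G"
  have "\<exists>c. y * v i = (\<Sum>j<k. of_int (c j) * v j)" if "i < k" for i
  proof -
    have "v i \<in> G" using v that unfolding k_def by (auto simp: bij_betw_def)
    then have "y * v i \<in> zspan G"
      using G assms(2) mul zspan_base by blast
    then obtain c where "y * v i = (\<Sum>g\<in>G. of_int (c g) * g)" unfolding zspan_def by blast
    also have "\<dots> = (\<Sum>j<k. of_int (c (v j)) * v j)"
      using sum.reindex_bij_betw[OF v, of "\<lambda>g. of_int (c g) * g"]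
      by (simp add: k_def lessThan_atLeast0)
    finally show ?thesis by (intro exI[of _ "\<lambda>j. c (v j)"])
  qed
  then obtain A :: "nat \<Rightarrow> nat \<Rightarrow> int"
    where A: "\<And>i. i < k \<Longrightarrow> y * v i = (\<Sum>j<k. of_int (A i j) * v j)"
    by metis
  define M where "M = mat k k (\<lambda>(i,j). A i j)"
  define V where "V = vec k v"
  define M' :: "'a mat" where "M' = map_mat of_int M"
  have M: "M \<in> carrier_mat k k" and M': "M' \<in> carrier_mat k k"
    by (auto simp: M_def M'_def)
  \<comment> \<open>If all generators vanished, the ring would be zero, but it contains 1.\<close>
  have "V \<noteq> 0\<^sub>v k"
  proof
    assume "V = 0\<^sub>v k"
    then have "v i = 0" if "i < k" for i
      using that unfolding V_def by (metis index_vec index_zero_vec(1))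
    then have "g = 0" if "g \<in> G" for g
      using v that unfolding k_def bij_betw_def by (metis atLeastLessThan_iff imageE)
    then have "(\<Sum>g\<in>G. of_int (c g) * g) = 0" for c :: "'a \<Rightarrow> int"
      by (intro sum.neutral) simp
    then have "x = 0" if "x \<in> zspan G" for x using that unfolding zspan_def by auto
    then show False using one G by force
  qed
  moreover have "M' *\<^sub>v V = y \<cdot>\<^sub>v V"
  proof (rule eq_vecI)
    fix i assume "i < dim_vec (y \<cdot>\<^sub>v V)"
    then have i: "i < k" by (simp add: V_def)
    have "(M' *\<^sub>v V) $ i = (\<Sum>j<k. of_int (A i j) * v j)"
      using i by (simp add: M'_def M_def V_def scalar_prod_def lessThan_atLeast0)
    then show "(M' *\<^sub>v V) $ i = (y \<cdot>\<^sub>v V) $ i"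
      using A[OF i] i by (simp add: V_def)
  qed (use M' in \<open>auto simp: V_def\<close>)
  ultimately have "eigenvalue M' y"
    unfolding eigenvalue_def eigenvector_def using M' by (intro exI[of _ V]) (auto simp: V_def)
  then have "poly (char_poly M') y = 0"
    using eigenvalue_root_char_poly[OF M'] by simp
  moreover have "char_poly M' = map_poly of_int (char_poly M)"
    unfolding M'_def by (rule of_int_hom.char_poly_hom[OF M])
  moreover have "Polynomial.lead_coeff (char_poly M) = 1"
    using degree_monic_char_poly[OF M] by simp
  ultimately show ?thesis
    unfolding algebraic_int_altdef_ipoly by metis
qed

text \<open>The products of a generator of \<open>S\<close> with \<open>y ^ i\<close> for
  \<open>i < d\<close> generate a suitable ring, because the monic relation rewrites all higher
  powers of \<open>y\<close>.\<close>

lemma finite_subring_adjoin: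
  assumes S: "finite_subring S" and d: "y ^ d = (\<Sum>i<d. c i * y ^ i)" "\<And>i. i < d \<Longrightarrow> c i \<in> S"
  shows "\<exists>S'. finite_subring S' \<and> S \<subseteq> S' \<and> y \<in> S'"
proof -
  obtain G where G: "finite G" "S = zspan G" and one: "1 \<in> S" and mul: "\<forall>x\<in>S. \<forall>y\<in>S. x * y \<in> S"
    using S unfolding finite_subring_def by blast
  define H where "H = (\<lambda>(g, i). g * y ^ i) ` (G \<times> {..<d})"
  have fin: "finite H" using G by (simp add: H_def)
  have key: "s * y ^ i \<in> zspan H" if "s \<in> S" for s i
    using that
  proof (induction i arbitrary: s rule: less_induct)
    case (less i)
    show ?case
    proof (cases "i < d")
      case True
      obtain b where "s = (\<Sum>g\<in>G. of_int (b g) * g)"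
        using less.prems G unfolding zspan_def by blast
      then have "s * y ^ i = (\<Sum>g\<in>G. of_int (b g) * (g * y ^ i))"
        by (simp add: sum_distrib_right mult.assoc)
      also have "\<dots> \<in> zspan H"
        using True fin by (intro zspan_sum zspan_of_int_mult zspan_base) (auto simp: H_def)
      finally show ?thesis .
    next
      case False
      \<comment> \<open>Substituting the relation for \<open>y ^ d\<close> leaves only the exponents
        \<open>i - d + j\<close> with \<open>j < d\<close>. They are below \<open>i\<close>, so the
        strong induction applies.\<close>
      then have "s * y ^ i = s * (y ^ (i - d) * y ^ d)"
        by (simp flip: power_add)
      also have "\<dots> = (\<Sum>j<d. (s * c j) * y ^ (i - d + j))"
        unfolding d(1) by (simp add: sum_distrib_left power_add algebra_simps)
      also have "\<dots> \<in> zspan H"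
        using False mul d(2) less.prems by (intro zspan_sum less.IH) auto
      finally show ?thesis .
    qed
  qed
  have "x * z \<in> zspan H" if "x \<in> zspan H" "z \<in> zspan H" for x z
  proof (rule zspan_mult[OF _ that])
    fix g h assume "g \<in> H" "h \<in> H"
    then obtain a i b j where *: "a \<in> G" "b \<in> G" "g = a * y ^ i" "h = b * y ^ j"
      unfolding H_def by auto
    have "g * h = (a * b) * y ^ (i + j)"
      using * by (simp add: power_add algebra_simps)
    then show "g * h \<in> zspan H"
      using key[of "a * b" "i + j"] *(1,2) mul zspan_base[OF G(1)] G(2) by metis
  qed
  moreover have "1 \<in> zspan H" "y \<in> zspan H" "S \<subseteq> zspan H"
    using key[OF one, of 0] key[OF one, of 1] key[of _ 0] by auto
  ultimately show ?thesis
    using fin unfolding finite_subring_def by blast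
qed

lemma algebraic_int_power_eq:
  assumes "algebraic_int (x :: 'a::field_char_0)"
  obtains d and c :: "nat \<Rightarrow> int" where "x ^ d = (\<Sum>i<d. of_int (c i) * x ^ i)"
proof -
  obtain q where q: "poly (map_poly of_int q) x = 0" "Polynomial.lead_coeff q = 1"
    using assms unfolding algebraic_int_altdef_ipoly by blast
  have "poly (map_poly of_int q) x = (\<Sum>i\<le>Polynomial.degree q. of_int (Polynomial.coeff q i) * x ^ i)"
    by (simp add: poly_altdef)
  also have "\<dots> = x ^ Polynomial.degree q + (\<Sum>i<Polynomial.degree q. of_int (Polynomial.coeff q i) * x ^ i)"
    using q(2) by (simp add: lessThan_Suc_atMost[symmetric])
  finally have "x ^ Polynomial.degree q = - (\<Sum>i<Polynomial.degree q. of_int (Polynomial.coeff q i) * x ^ i)"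
    using q(1) by (simp add: eq_neg_iff_add_eq_0)
  also have "\<dots> = (\<Sum>i<Polynomial.degree q. of_int (- Polynomial.coeff q i) * x ^ i)"
    by (simp add: sum_negf)
  finally show ?thesis by (rule that)
qed

text \<open>The elements are adjoined one at a time, starting from \<open>zspan {1}\<close>, the
  image of the integers.\<close>

lemma finite_subring_contains_algebraic_ints:
  fixes A :: "'a::field_char_0 set"
  assumes "finite A" "\<And>x. x \<in> A \<Longrightarrow> algebraic_int x"
  shows "\<exists>S. finite_subring S \<and> A \<subseteq> S"
  using assms
proof (induction A rule: finite_induct)
  case empty
  have "1 \<in> zspan {1 :: 'a}" by (simp add: zspan_base)
  moreover have "x * y \<in> zspan {1 :: 'a}" if "x \<in> zspan {1}" "y \<in> zspan {1}" for x y :: 'a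
    using zspan_mult[OF _ that, of "{1}"] by (simp add: zspan_base)
  ultimately have "finite_subring (zspan {1 :: 'a})"
    unfolding finite_subring_def by blast
  then show ?case by auto
next
  case (insert x A)
  then obtain S where S: "finite_subring S" "A \<subseteq> S" by auto
  have int: "of_int k \<in> S" for k
    using S(1) zspan_of_int_mult[of 1 _ k] unfolding finite_subring_def by auto
  obtain d and c :: "nat \<Rightarrow> int" where "x ^ d = (\<Sum>i<d. of_int (c i) * x ^ i)"
    using algebraic_int_power_eq insert.prems by blast
  from finite_subring_adjoin[OF S(1) this int] S(2) show ?case by blast
qed

lemma algebraic_int_add_mult:
  fixes x y :: "'a::field_char_0"
  assumes "algebraic_int x" "algebraic_int y"
  shows algebraic_int_add: "algebraic_int (x + y)" and algebraic_int_mult: "algebraic_int (x * y)"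
proof -
  obtain S where S: "finite_subring S" "{x, y} \<subseteq> S"
    using finite_subring_contains_algebraic_ints[of "{x, y}"] assms by auto
  then have "x + y \<in> S" "x * y \<in> S"
    unfolding finite_subring_def by (auto intro: zspan_add)
  then show "algebraic_int (x + y)" "algebraic_int (x * y)"
    using S(1) finite_subring_algebraic_int by blast+
qed

text \<open>Transitivity of integrality: the coefficients lie in one finitely generated ring, and
  adjoining \<open>y\<close> to it keeps it finitely generated.\<close>

lemma algebraic_int_integral:
  fixes y :: "'a::field_char_0"
  assumes "y ^ d = (\<Sum>i<d. c i * y ^ i)" "\<And>i. i < d \<Longrightarrow> algebraic_int (c i)"
  shows "algebraic_int y"
proof -
  obtain S where S: "finite_subring S" "c ` {..<d} \<subseteq> S"
    using finite_subring_contains_algebraic_ints[of "c ` {..<d}"] assms(2) by auto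
  then show ?thesis
    using finite_subring_adjoin[OF S(1) assms(1)] finite_subring_algebraic_int by blast
qed

lemma algebraic_int_diff:
  "algebraic_int x \<Longrightarrow> algebraic_int y \<Longrightarrow> algebraic_int (x - y :: 'a::field_char_0)"
  using algebraic_int_add[of x "- y"] by simp

lemma algebraic_int_power: "algebraic_int x \<Longrightarrow> algebraic_int (x ^ k :: 'a::field_char_0)"
  by (induction k) (auto intro: algebraic_int_mult)

lemma algebraic_int_quadratic:
  fixes w :: "'a::field_char_0"
  assumes "w\<^sup>2 = a * w + b" "algebraic_int a" "algebraic_int b"
  shows "algebraic_int w"
proof (rule algebraic_int_integral[of w 2 "\<lambda>i. if i = 0 then b else a"])
  show "w\<^sup>2 = (\<Sum>i<2. (if i = 0 then b else a) * w ^ i)"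
    using assms(1) by (simp add: numeral_2_eq_2)
qed (use assms in auto)

section \<open>Finiteness of residue rings\<close>

lemma algebraic_int_of_int [simp]: "algebraic_int (of_int k :: 'a::field_char_0)"
  by (simp add: int_imp_algebraic_int)

lemma algebraic_int_of_nat [simp]: "algebraic_int (of_nat k :: 'a::field_char_0)"
  by (simp add: int_imp_algebraic_int)

lemma algebraic_int_1 [simp]: "algebraic_int (1 :: 'a::field_char_0)"
  by (simp add: int_imp_algebraic_int)

lemma algebraic_int_sum:
  "(\<And>i. i \<in> A \<Longrightarrow> algebraic_int (h i :: 'a::field_char_0)) \<Longrightarrow> algebraic_int (sum h A)"
  by (induction A rule: infinite_finite_induct) (auto intro: algebraic_int_add)

lemmas algebraic_int_intros = algebraic_int_add algebraic_int_mult algebraic_int_diff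
  algebraic_int_power algebraic_int_sum algebraic_int_of_int algebraic_int_of_nat algebraic_int_1
  algebraic_int_0

lemma mem_integers_of_UNIV [simp]: "x \<in> integers_of UNIV \<longleftrightarrow> algebraic_int x"
  by (simp add: integers_of_def)

text \<open>Redundant representatives are allowed: what is recorded is that the quotient modulo
  \<open>N\<close> is finite.\<close>

definition covers_mod :: "'a::field_char_0 set \<Rightarrow> nat \<Rightarrow> bool" where
  "covers_mod A N \<longleftrightarrow> finite A \<and> (\<forall>x\<in>A. algebraic_int x) \<and>
     (\<forall>y. algebraic_int y \<longrightarrow> (\<exists>x\<in>A. \<exists>z. algebraic_int z \<and> y = x + of_nat N * z))"

text \<open>For prime \<open>p\<close> this is linear independence, over the field with
  \<open>p\<close> elements, of the classes in the quotient modulo \<open>p\<close>.\<close>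

definition independent_mod :: "nat \<Rightarrow> 'a::field_char_0 set \<Rightarrow> bool" where
  "independent_mod p A \<longleftrightarrow> finite A \<and> (\<forall>x\<in>A. algebraic_int x) \<and>
     (\<forall>c :: 'a \<Rightarrow> int. (\<exists>z. algebraic_int z \<and> (\<Sum>x\<in>A. of_int (c x) * x) = of_nat p * z) \<longrightarrow>
        (\<forall>x\<in>A. int p dvd c x))"

lemma independent_modD:
  assumes "independent_mod p A" "algebraic_int z" "(\<Sum>x\<in>A. of_int (c x) * x) = of_nat p * z" "x \<in> A"
  shows "int p dvd c x"
  using assms unfolding independent_mod_def by blast

lemma common_denominator:
  assumes "finite A"
  shows "\<exists>D::int. D > 0 \<and> (\<forall>x\<in>A. \<exists>k::int. of_int D * (u x :: rat) = of_int k)"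
  using assms
proof (induction A rule: finite_induct)
  case (insert x A)
  then obtain D where D: "D > 0" "\<forall>y\<in>A. \<exists>k::int. of_int D * u y = of_int k" by blast
  obtain a b where ab: "quotient_of (u x) = (a, b)" by fastforce
  then have b: "b > 0" "u x = of_int a / of_int b"
    by (auto simp: quotient_of_denom_pos quotient_of_div)
  have "\<exists>k::int. of_int (b * D) * u y = of_int k" if y: "y \<in> insert x A" for y
  proof (cases "y = x")
    case True
    then have "of_int (b * D) * u y = of_int (D * a)" using b by simp
    then show ?thesis by blast
  next
    case False
    then obtain k where "of_int D * u y = of_int k" using D y by auto
    then have "of_int (b * D) * u y = of_int (b * k)" by (simp add: mult.assoc)
    then show ?thesis by blast
  qed
  then show ?case using b D by (intro exI[of _ "b * D"]) auto
qed (auto intro: exI[of _ 1])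

text \<open>Infinite descent: all coefficients are divisible by \<open>p\<close>, and dividing by
  \<open>p\<close> gives another relation, so every power of \<open>p\<close> divides
  \<open>c x\<close>.\<close>

lemma independent_mod_relation:
  assumes "independent_mod p A" "p > 1" "(\<Sum>x\<in>A. of_int (c x) * x) = 0" "x \<in> A"
  shows "c x = 0"
proof -
  have "int p ^ k dvd c x" for k
    using assms(3)
  proof (induction k arbitrary: c)
    case (Suc k)
    have "int p dvd c y" if "y \<in> A" for y
      using independent_modD[OF assms(1), of 0 c] Suc.prems that by simp
    then obtain d where d: "\<And>y. y \<in> A \<Longrightarrow> c y = int p * d y" unfolding dvd_def by metis
    have "of_nat p * (\<Sum>x\<in>A. of_int (d x) * x) = (\<Sum>x\<in>A. of_int (c x) * x)"
      unfolding sum_distrib_left by (rule sum.cong) (auto simp: d)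
    with Suc.prems \<open>p > 1\<close> have "(\<Sum>x\<in>A. of_int (d x) * x) = 0" by simp
    from Suc.IH[OF this] show ?case using d[OF assms(4)] by simp
  qed simp
  \<comment> \<open>The exponent is taken to be the absolute value of \<open>c x\<close>: since
    \<open>p ^ k > k\<close>, a nonzero \<open>c x\<close> would be smaller than its
    divisor.\<close>
  then have "int p ^ nat \<bar>c x\<bar> dvd c x" .
  moreover have "int (nat \<bar>c x\<bar>) < int (p ^ nat \<bar>c x\<bar>)"
    using power_gt_expt[of p "nat \<bar>c x\<bar>"] \<open>p > 1\<close> by (simp only: of_nat_less_iff)
  ultimately show ?thesis
    using dvd_imp_le_int[of "c x" "int p ^ nat \<bar>c x\<bar>"] by (cases "c x = 0") (simp_all del: of_nat_power_less_of_nat_cancel_iff)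
qed

text \<open>Clearing denominators in a rational dependence gives an integral one, which must be
  trivial. So independence modulo \<open>p\<close> implies independence over the rationals, and the
  degree of the number field bounds the size.\<close>

lemma independent_mod_card_bounded:
  assumes "number_field TYPE('a::field_char_0)" "p > 1"
  shows "\<exists>d. \<forall>A :: 'a set. independent_mod p A \<longrightarrow> card A < d"
proof -
  obtain B :: "'a set" where "finite_dimensional_vector_space (\<lambda>q x. of_rat q * x) B"
    using assms(1) unfolding number_field_def by blast
  then interpret V: finite_dimensional_vector_space "\<lambda>q x :: 'a. of_rat q * x" B .
  have "card A \<le> card B" if A: "independent_mod p A" for A :: "'a set"
  proof -
    have fin: "finite A" using A by (simp add: independent_mod_def)
    have "\<not> V.dependent A"
    proof
      assume "V.dependent A"
      then obtain u v where u: "v \<in> A" "u v \<noteq> 0" "(\<Sum>v\<in>A. of_rat (u v) * v) = 0"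
        unfolding V.dependent_finite[OF fin] by blast
      obtain D where D: "D > 0" "\<forall>x\<in>A. \<exists>k::int. of_int D * u x = of_int k"
        using common_denominator[OF fin] by blast
      then obtain k :: "'a \<Rightarrow> int" where k: "\<And>x. x \<in> A \<Longrightarrow> of_int D * u x = of_int (k x)"
        by metis
      have "(\<Sum>x\<in>A. of_int (k x) * x) = of_int D * (\<Sum>x\<in>A. of_rat (u x) * x)"
        unfolding sum_distrib_left
      proof (rule sum.cong[OF refl])
        fix x assume "x \<in> A"
        then have "(of_rat (of_int (k x)) :: 'a) = of_rat (of_int D * u x)" using k by simp
        then show "of_int (k x) * x = of_int D * (of_rat (u x) * x)"
          by (simp add: of_rat_mult)
      qed
      then have "k v = 0"
        using independent_mod_relation[OF A assms(2) _ u(1)] u(3) by simp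
      then show False using k[OF u(1)] D(1) u(2) by simp
    qed
    then show ?thesis
      using V.independent_span_bound[OF V.finite_Basis, of A] V.span_Basis by auto
  qed
  then show ?thesis by (intro exI[of _ "Suc (card B)"]) (auto simp: less_Suc_eq_le)
qed

text \<open>A rational dependence among the powers of \<open>x\<close> becomes integral after
  clearing denominators; its leading coefficient is the required \<open>c\<close>.\<close>

lemma number_field_denominator:
  assumes "number_field TYPE('a::field_char_0)"
  shows "\<exists>c::int. c \<noteq> 0 \<and> algebraic_int (of_int c * (x :: 'a))"
proof -
  obtain B :: "'a set" where "finite_dimensional_vector_space (\<lambda>q x. of_rat q * x) B"
    using assms unfolding number_field_def by blast
  then interpret V: finite_dimensional_vector_space "\<lambda>q x :: 'a. of_rat q * x" B .
  show ?thesis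
  proof (cases "inj_on (\<lambda>i. x ^ i) {..card B}")
    \<comment> \<open>Coinciding powers would collapse in the image set \<open>W\<close>. Here
      \<open>x ^ j = x ^ i\<close> is itself a monic equation for \<open>x\<close>.\<close>
    case False
    then obtain i j where ij: "i < j" "x ^ j = x ^ i"
      unfolding inj_on_def by (metis linorder_neqE_nat)
    then have "x ^ j = (\<Sum>l<j. (if l = i then 1 else 0) * x ^ l)"
      by (simp add: if_distrib[of "\<lambda>z. z * _"] cong: if_cong)
    then have "algebraic_int x" by (rule algebraic_int_integral) simp
    then show ?thesis by (intro exI[of _ 1]) simp
  next
    case inj: True
    define W where "W = (\<lambda>i. x ^ i) ` {..card B}"
    have fin: "finite W" by (simp add: W_def)
    have "card W = Suc (card B)" using inj by (simp add: W_def card_image)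
    then have "V.dependent W"
      using V.independent_span_bound[OF V.finite_Basis, of W] V.span_Basis by auto
    then obtain u v where u: "v \<in> W" "u v \<noteq> 0" "(\<Sum>v\<in>W. of_rat (u v) * v) = 0"
      unfolding V.dependent_finite[OF fin] by blast
    obtain D where D: "D > 0" "\<forall>i\<in>{..card B}. \<exists>k::int. of_int D * u (x ^ i) = of_int k"
      using common_denominator[of "{..card B}" "\<lambda>i. u (x ^ i)"] by auto
    then obtain c :: "nat \<Rightarrow> int"
      where c: "\<And>i. i \<le> card B \<Longrightarrow> of_int D * u (x ^ i) = of_int (c i)" by (metis atMost_iff)
    have "(\<Sum>i\<le>card B. of_int (c i) * x ^ i) = of_int D * (\<Sum>i\<le>card B. of_rat (u (x ^ i)) * x ^ i)"
      unfolding sum_distrib_left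
    proof (rule sum.cong[OF refl])
      fix i assume "i \<in> {..card B}"
      then have "(of_rat (of_int (c i)) :: 'a) = of_rat (of_int D * u (x ^ i))" using c by simp
      then show "of_int (c i) * x ^ i = of_int D * (of_rat (u (x ^ i)) * x ^ i)"
        by (simp add: of_rat_mult)
    qed
    also have "(\<Sum>i\<le>card B. of_rat (u (x ^ i)) * x ^ i) = 0"
      using u(3) inj unfolding W_def by (simp add: sum.reindex)
    finally have rel: "(\<Sum>i\<le>card B. of_int (c i) * x ^ i) = 0" by simp
    obtain i0 where "i0 \<le> card B" "c i0 \<noteq> 0"
    proof -
      obtain i where "i \<le> card B" "v = x ^ i" using u(1) by (auto simp: W_def)
      then have "c i \<noteq> 0" using c[of i] D(1) u(2) by auto
      then show ?thesis using that \<open>i \<le> card B\<close> by blast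
    qed
    define k where "k = Max {i. i \<le> card B \<and> c i \<noteq> 0}"
    have "k \<in> {i. i \<le> card B \<and> c i \<noteq> 0}"
      unfolding k_def using \<open>i0 \<le> card B\<close> \<open>c i0 \<noteq> 0\<close> by (intro Max_in) auto
    then have k: "k \<le> card B" "c k \<noteq> 0" by auto
    have above: "c i = 0" if "i \<le> card B" "k < i" for i
    proof (rule ccontr)
      assume "c i \<noteq> 0"
      then have "i \<le> k" unfolding k_def using that(1) by (intro Max_ge) auto
      then show False using that(2) by simp
    qed
    have "(\<Sum>i\<le>card B. of_int (c i) * x ^ i) = (\<Sum>i\<le>k. of_int (c i) * x ^ i)"
      using k(1) above by (intro sum.mono_neutral_right) auto
    also have "\<dots> = of_int (c k) * x ^ k + (\<Sum>i<k. of_int (c i) * x ^ i)"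
      by (simp add: lessThan_Suc_atMost[symmetric])
    finally have eq: "of_int (c k) * x ^ k = - (\<Sum>i<k. of_int (c i) * x ^ i)"
      using rel by (simp add: eq_neg_iff_add_eq_0)
    have "k > 0" using eq k(2) by (cases k) auto
    \<comment> \<open>Multiplying the relation by \<open>c k ^ (k - 1)\<close> makes it monic in
      \<open>c k * x\<close>, with integral lower coefficients.\<close>
    then have "(of_int (c k) * x) ^ k = of_int (c k) ^ (k - 1) * (of_int (c k) * x ^ k)"
      by (cases k) (simp_all add: power_mult_distrib mult_ac)
    also have "\<dots> = (\<Sum>i<k. of_int (- (c i * c k ^ (k - 1 - i))) * (of_int (c k) * x) ^ i)"
      unfolding eq sum_negf[symmetric] sum_distrib_left
    proof (rule sum.cong[OF refl])
      fix i assume "i \<in> {..<k}"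
      then have "k - 1 = (k - 1 - i) + i" by simp
      then have "(of_int (c k) :: 'a) ^ (k - 1) = of_int (c k) ^ (k - 1 - i) * of_int (c k) ^ i"
        by (metis power_add)
      then show "of_int (c k) ^ (k - 1) * - (of_int (c i) * x ^ i) =
          of_int (- (c i * c k ^ (k - 1 - i))) * (of_int (c k) * x) ^ i"
        by (simp add: power_mult_distrib mult_ac)
    qed
    finally have "algebraic_int (of_int (c k) * x)"
      by (rule algebraic_int_integral) (rule algebraic_int_of_int)
    then show ?thesis using k(2) by blast
  qed
qed

text \<open>A largest set independent modulo \<open>p\<close> spans the quotient modulo
  \<open>p\<close>, so its combinations with coefficients in \<open>{0..<int p}\<close> represent
  all classes.\<close>

lemma covers_mod_prime:
  assumes "number_field TYPE('a::field_char_0)" "Factorial_Ring.prime (p::nat)"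
  shows "\<exists>A :: 'a set. covers_mod A p"
proof -
  have p: "p > 1" using assms(2) prime_gt_1_nat by blast
  obtain d where d: "\<And>A :: 'a set. independent_mod p A \<Longrightarrow> card A < d"
    using independent_mod_card_bounded[OF assms(1) p] by blast
  have "independent_mod p ({} :: 'a set)" by (simp add: independent_mod_def)
  then obtain A :: "'a set" where A: "independent_mod p A"
    and max: "\<And>B :: 'a set. independent_mod p B \<Longrightarrow> card B \<le> card A"
    using Lattices_Big.ex_has_greatest_nat[of "independent_mod p" "{} :: 'a set" card d] d by blast
  have fin: "finite A" and alg: "\<And>x. x \<in> A \<Longrightarrow> algebraic_int x"
    using A by (auto simp: independent_mod_def)
  define C where "C = (\<lambda>c. \<Sum>x\<in>A. of_int (c x) * x) ` PiE A (\<lambda>_. {0..<int p})"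
  \<comment> \<open>Coefficients are reduced modulo \<open>p\<close>; their quotients by
    \<open>p\<close> are moved into the multiple of \<open>p\<close>.\<close>
  have reduce: "\<exists>x\<in>C. \<exists>z. algebraic_int z \<and> y = x + of_nat p * z"
    if "y = (\<Sum>x\<in>A. of_int (c x) * x) + of_nat p * z" "algebraic_int z" for y z and c :: "'a \<Rightarrow> int"
  proof -
    define r where "r = restrict (\<lambda>x. c x mod int p) A"
    have "(\<Sum>x\<in>A. of_int (r x) * x) \<in> C"
      unfolding C_def using p by (intro imageI) (auto simp: r_def)
    moreover have "y = (\<Sum>x\<in>A. of_int (r x) * x) + of_nat p * ((\<Sum>x\<in>A. of_int (c x div int p) * x) + z)"
    proof -
      have "(\<Sum>x\<in>A. of_int (c x) * x) =
          (\<Sum>x\<in>A. of_int (r x) * x + of_nat p * (of_int (c x div int p) * x))"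
      proof (rule sum.cong[OF refl])
        fix x assume "x \<in> A"
        then have e: "r x + int p * (c x div int p) = c x" by (simp add: r_def)
        have "of_int (r x) * x + of_nat p * (of_int (c x div int p) * x)
            = of_int (r x + int p * (c x div int p)) * x"
          by (simp add: algebra_simps)
        then show "of_int (c x) * x = of_int (r x) * x + of_nat p * (of_int (c x div int p) * x)"
          unfolding e by (rule sym)
      qed
      then show ?thesis using that(1) by (simp add: sum.distrib sum_distrib_left algebra_simps)
    qed
    moreover have "algebraic_int ((\<Sum>x\<in>A. of_int (c x div int p) * x) + z)"
      using alg that(2) by (intro algebraic_int_add algebraic_int_sum algebraic_int_mult) simp_all
    ultimately show ?thesis by blast
  qed
  have "finite C" unfolding C_def using fin by (intro finite_imageI finite_PiE) auto
  moreover have "\<forall>x\<in>C. algebraic_int x" unfolding C_def using alg by (auto intro!: algebraic_int_intros)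
  moreover have "\<exists>x\<in>C. \<exists>z. algebraic_int z \<and> y = x + of_nat p * z" if y: "algebraic_int y" for y
  proof (cases "y \<in> A")
    case True
    then have "(\<Sum>x\<in>A. of_int (if x = y then 1 else 0) * x) = y"
      using fin by (simp add: if_distrib[of of_int] if_distrib[of "\<lambda>z. z * _"] cong: if_cong)
    then have "y = (\<Sum>x\<in>A. of_int (if x = y then 1 else 0) * x) + of_nat p * 0" by simp
    then show ?thesis by (rule reduce) simp
  next
    case False
    then have "\<not> independent_mod p (insert y A)"
      using max[of "insert y A"] fin by auto
    then obtain c :: "'a \<Rightarrow> int" and z x where c: "algebraic_int z"
      "(\<Sum>x\<in>insert y A. of_int (c x) * x) = of_nat p * z" "x \<in> insert y A" "\<not> int p dvd c x"
      unfolding independent_mod_def using fin alg y by auto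
    then have eq: "of_int (c y) * y + (\<Sum>x\<in>A. of_int (c x) * x) = of_nat p * z"
      using False fin by simp
    \<comment> \<open>Maximality of \<open>A\<close> supplies a nontrivial relation involving
      \<open>y\<close>. If its coefficient at \<open>y\<close> were divisible by \<open>p\<close>,
      that term could join the right-hand side and independence of \<open>A\<close> would make the
      relation trivial. So the coefficient has an inverse \<open>s\<close> modulo \<open>p\<close>,
      and the relation can be solved for \<open>y\<close>.\<close>
    have "\<not> int p dvd c y"
    proof
      assume "int p dvd c y"
      then obtain k where "c y = int p * k" by (rule dvdE)
      then have "(\<Sum>x\<in>A. of_int (c x) * x) = of_nat p * (z - of_int k * y)"
        using eq by (simp add: algebra_simps)
      moreover have "algebraic_int (z - of_int k * y)" using c y by (auto intro: algebraic_int_intros)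
      ultimately have "int p dvd c x" if "x \<in> A" for x using independent_modD[OF A _ _ that] by blast
      then show False using c(3,4) \<open>int p dvd c y\<close> by blast
    qed
    then have "coprime (c y) (int p)"
      using assms(2) prime_imp_coprime[of "int p" "c y"] by (simp add: coprime_commute)
    then obtain s where "[c y * s = 1] (mod int p)" using cong_solve_coprime_int by blast
    then have "\<exists>w. c y * s = 1 + int p * w"
      by (subst (asm) cong_sym_eq) (simp add: cong_iff_lin)
    then obtain w where w: "c y * s = 1 + int p * w" by blast
    have "of_int (c y * s) = (1 + of_nat p * of_int w :: 'a)"
      unfolding w by simp
    then have "of_int (c y) * of_int s * y = (1 + of_nat p * of_int w) * y" by simp
    then have y_eq: "of_int s * (of_int (c y) * y) - of_nat p * of_int w * y = y"
      by (simp add: algebra_simps)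
    define T where "T = (\<Sum>x\<in>A. of_int (c x) * x)"
    have cy: "of_int (c y) * y = of_nat p * z - T"
      using eq unfolding T_def by (simp add: algebra_simps)
    have "of_int (- s) * T + of_nat p * (of_int s * z - of_int w * y)
        = of_int s * (of_nat p * z - T) - of_nat p * of_int w * y"
      by (simp add: algebra_simps)
    then have "y = of_int (- s) * T + of_nat p * (of_int s * z - of_int w * y)"
      using y_eq unfolding cy by (rule trans[THEN sym])
    also have "of_int (- s) * T = (\<Sum>x\<in>A. of_int (- s * c x) * x)"
      unfolding T_def sum_distrib_left by (simp only: of_int_mult mult.assoc)
    finally have "y = (\<Sum>x\<in>A. of_int (- s * c x) * x) + of_nat p * (of_int s * z - of_int w * y)" .
    then show ?thesis by (rule reduce) (use c y in \<open>auto intro: algebraic_int_intros\<close>)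
  qed
  ultimately show ?thesis unfolding covers_mod_def by blast
qed

lemma covers_mod_mult:
  assumes "covers_mod A M" "covers_mod B N"
  shows "covers_mod ((\<lambda>(x, y). x + of_nat M * y) ` (A \<times> B)) (M * N)"
  unfolding covers_mod_def
proof (intro conjI allI impI)
  fix y :: 'a assume "algebraic_int y"
  then obtain x z where x: "x \<in> A" "algebraic_int z" "y = x + of_nat M * z"
    using assms(1) unfolding covers_mod_def by blast
  then obtain x' z' where x': "x' \<in> B" "algebraic_int z'" "z = x' + of_nat N * z'"
    using assms(2) unfolding covers_mod_def by blast
  have "y = (x + of_nat M * x') + of_nat (M * N) * z'"
    unfolding x(3) x'(3) by (simp add: algebra_simps)
  moreover have "x + of_nat M * x' \<in> (\<lambda>(x, y). x + of_nat M * y) ` (A \<times> B)"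
    using x(1) x'(1) by force
  ultimately show "\<exists>x\<in>(\<lambda>(x, y). x + of_nat M * y) ` (A \<times> B). \<exists>z. algebraic_int z \<and> y = x + of_nat (M * N) * z"
    using x'(2) by blast
next
  have "finite A" "finite B" "\<forall>x\<in>A. algebraic_int x" "\<forall>x\<in>B. algebraic_int x"
    using assms unfolding covers_mod_def by blast+
  then show "finite ((\<lambda>(x, y). x + of_nat M * y) ` (A \<times> B))"
    and "\<forall>x\<in>(\<lambda>(x, y). x + of_nat M * y) ` (A \<times> B). algebraic_int x"
    by (blast, force intro: algebraic_int_add algebraic_int_mult algebraic_int_of_nat)
qed

text \<open>Finiteness modulo \<open>N\<close>, by splitting off one prime factor at a time. It
  serves in place of an integral basis: the ascending chain and dimension-one arguments for ideals
  rest on it.\<close>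

lemma covers_mod_exists:
  assumes "number_field TYPE('a::field_char_0)" "N > 0"
  shows "\<exists>A :: 'a set. covers_mod A N"
  using assms(2)
proof (induction N rule: less_induct)
  case (less N)
  show ?case
  proof (cases "N = 1")
    case True
    have "covers_mod {0 :: 'a} 1" by (auto simp: covers_mod_def)
    then show ?thesis using True by blast
  next
    case False
    then obtain p where p: "Factorial_Ring.prime p" "p dvd N" using prime_factor_nat by blast
    then obtain M where M: "N = p * M" by blast
    have "M > 0" using less.prems M by simp
    moreover have "M < N" using \<open>M > 0\<close> prime_gt_1_nat[OF p(1)] M by simp
    ultimately obtain A B :: "'a set" where "covers_mod A M" "covers_mod B p"
      using less.IH covers_mod_prime[OF assms(1) p(1)] by blast
    then show ?thesis using covers_mod_mult[of B p A M] M by blast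
  qed
qed

section \<open>Invertibility of primes\<close>

lemma ring_of_integers_simps [simp]:
  "carrier (ring_of_integers :: 'a::field_char_0 ring) = {x. algebraic_int x}"
  "x \<otimes>\<^bsub>ring_of_integers\<^esub> y = (x * y :: 'a)"
  "x \<oplus>\<^bsub>ring_of_integers\<^esub> y = (x + y :: 'a)"
  "\<one>\<^bsub>ring_of_integers\<^esub> = (1 :: 'a)"
  "\<zero>\<^bsub>ring_of_integers\<^esub> = (0 :: 'a)"
  by (auto simp: ring_of_integers_def ring_of_type_algebra_def)

lemma cring_ring_of_integers: "cring (ring_of_integers :: 'a::field_char_0 ring)"
proof (rule cringI)
  show "abelian_group (ring_of_integers :: 'a ring)"
  proof (rule abelian_groupI)
    fix x :: 'a assume "x \<in> carrier ring_of_integers"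
    then show "\<exists>y\<in>carrier ring_of_integers. y \<oplus>\<^bsub>ring_of_integers\<^esub> x = \<zero>\<^bsub>ring_of_integers\<^esub>"
      by (intro bexI[of _ "- x"]) auto
  qed (auto simp: algebraic_int_add)
  show "comm_monoid (ring_of_integers :: 'a ring)"
    by (rule comm_monoidI) (auto simp: algebraic_int_mult)
qed (auto simp: algebra_simps)

lemma ideal_integers_iff:
  "ideal I (ring_of_integers :: 'a::field_char_0 ring) \<longleftrightarrow>
     (\<forall>x\<in>I. algebraic_int x) \<and> 0 \<in> I \<and> (\<forall>x\<in>I. \<forall>y\<in>I. x + y \<in> I) \<and>
     (\<forall>x\<in>I. \<forall>a. algebraic_int a \<longrightarrow> a * x \<in> I)"
proof
  assume "ideal I (ring_of_integers :: 'a ring)"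
  then interpret ideal I "ring_of_integers :: 'a ring" .
  show "(\<forall>x\<in>I. algebraic_int x) \<and> 0 \<in> I \<and> (\<forall>x\<in>I. \<forall>y\<in>I. x + y \<in> I) \<and>
     (\<forall>x\<in>I. \<forall>a. algebraic_int a \<longrightarrow> a * x \<in> I)"
    using a_subset additive_subgroup.zero_closed[OF is_additive_subgroup]
      additive_subgroup.a_closed[OF is_additive_subgroup] I_l_closed by auto
next
  interpret cring "ring_of_integers :: 'a ring" by (rule cring_ring_of_integers)
  assume I: "(\<forall>x\<in>I. algebraic_int x) \<and> 0 \<in> I \<and> (\<forall>x\<in>I. \<forall>y\<in>I. x + y \<in> I) \<and>
     (\<forall>x\<in>I. \<forall>a. algebraic_int a \<longrightarrow> a * x \<in> I)"
  have uminus: "\<ominus>\<^bsub>ring_of_integers\<^esub> x = - x" if "algebraic_int x" for x :: 'a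
    using minus_equality[of "- x" x] that by simp
  show "ideal I (ring_of_integers :: 'a ring)"
  proof (rule idealI[OF ring_axioms])
    show "subgroup I (add_monoid (ring_of_integers :: 'a ring))"
    proof (rule subgroup.intro)
      fix x assume x: "x \<in> I"
      then have "-1 * x \<in> I" using I algebraic_int_of_int[of "-1"] by (metis of_int_1 of_int_minus)
      then show "inv\<^bsub>add_monoid ring_of_integers\<^esub> x \<in> I"
        using uminus[of x] x I by (simp add: a_inv_def)
    qed (use I in auto)
  qed (use I in \<open>auto simp: mult.commute\<close>)
qed

lemma ideal_integersD:
  assumes "ideal I (ring_of_integers :: 'a::field_char_0 ring)"
  shows "x \<in> I \<Longrightarrow> algebraic_int x" "0 \<in> I" "x \<in> I \<Longrightarrow> y \<in> I \<Longrightarrow> x + y \<in> I"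
    "x \<in> I \<Longrightarrow> algebraic_int a \<Longrightarrow> a * x \<in> I" "x \<in> I \<Longrightarrow> algebraic_int a \<Longrightarrow> x * a \<in> I"
    "x \<in> I \<Longrightarrow> - x \<in> I" "x \<in> I \<Longrightarrow> y \<in> I \<Longrightarrow> x - y \<in> I"
proof -
  show add: "x \<in> I \<Longrightarrow> y \<in> I \<Longrightarrow> x + y \<in> I" for x y
    using assms unfolding ideal_integers_iff by blast
  show mul: "x \<in> I \<Longrightarrow> algebraic_int a \<Longrightarrow> a * x \<in> I" for x a
    using assms unfolding ideal_integers_iff by blast
  then show "x \<in> I \<Longrightarrow> algebraic_int a \<Longrightarrow> x * a \<in> I" by (metis mult.commute)
  show neg: "x \<in> I \<Longrightarrow> - x \<in> I" for x using mul[of x "-1"] by simp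
  show "x \<in> I \<Longrightarrow> y \<in> I \<Longrightarrow> x - y \<in> I" using add[OF _ neg] by fastforce
qed (use assms in \<open>auto simp: ideal_integers_iff\<close>)

lemma prime_integers_iff:
  "primeideal P (ring_of_integers :: 'a::field_char_0 ring) \<longleftrightarrow>
     ideal P ring_of_integers \<and> 1 \<notin> P \<and>
     (\<forall>a b. algebraic_int a \<longrightarrow> algebraic_int b \<longrightarrow> a * b \<in> P \<longrightarrow> a \<in> P \<or> b \<in> P)"
proof
  assume "primeideal P (ring_of_integers :: 'a ring)"
  then interpret primeideal P "ring_of_integers :: 'a ring" .
  have "1 \<notin> P" using one_imp_carrier I_notcarr by auto
  then show "ideal P ring_of_integers \<and> 1 \<notin> P \<and>
     (\<forall>a b. algebraic_int a \<longrightarrow> algebraic_int b \<longrightarrow> a * b \<in> P \<longrightarrow> a \<in> P \<or> b \<in> P)"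
    using is_ideal I_prime by auto
next
  assume *: "ideal P ring_of_integers \<and> 1 \<notin> P \<and>
     (\<forall>a b. algebraic_int a \<longrightarrow> algebraic_int b \<longrightarrow> a * b \<in> P \<longrightarrow> a \<in> P \<or> b \<in> P)"
  then have "carrier ring_of_integers \<noteq> P" using algebraic_int_1 by (auto simp del: algebraic_int_1)
  with * show "primeideal P ring_of_integers"
    by (intro primeidealI cring_ring_of_integers) auto
qed

lemma prime_power_mem:
  assumes "primeideal P (ring_of_integers :: 'a::field_char_0 ring)" "algebraic_int a" "a ^ k \<in> P"
  shows "a \<in> P"
  using assms(3)
proof (induction k)
  case 0
  then show ?case using assms(1) by (simp add: prime_integers_iff)
next
  case (Suc k)
  have "a * a ^ k \<in> P" using Suc.prems by simp
  then have "a \<in> P \<or> a ^ k \<in> P"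
    using assms algebraic_int_power[of a k] unfolding prime_integers_iff by blast
  then show ?case using Suc.IH by blast
qed

lemma algebraic_int_poly_of_int:
  "algebraic_int a \<Longrightarrow> algebraic_int (poly (map_poly of_int r) (a :: 'a::field_char_0))"
proof (induction r)
  case (pCons c r)
  then show ?case by (auto simp: map_poly_pCons intro!: algebraic_int_add algebraic_int_mult)
qed simp

text \<open>The first nonzero low-order coefficient of an integral equation for \<open>a\<close> is
  a multiple of \<open>a\<close>; vanishing ones are removed by cancelling \<open>a\<close>. The
  cofactor is given as a polynomial in \<open>a\<close>, so that it stays in every ring containing
  \<open>a\<close>.\<close>

lemma algebraic_int_dvd_of_nat:
  assumes "algebraic_int (a :: 'a::field_char_0)" "a \<noteq> 0"
  shows "\<exists>(r :: int poly) N. N > 0 \<and> a * poly (map_poly of_int r) a = of_nat N"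
proof -
  have "\<exists>(r :: int poly) c. c \<noteq> 0 \<and> a * poly (map_poly of_int r) a = of_int c"
    if "poly (map_poly of_int q) a = 0" "q \<noteq> 0" for q :: "int poly"
    using that
  proof (induction q)
    case (pCons c q)
    have eq: "of_int c + a * poly (map_poly of_int q) a = 0"
      using pCons.prems by (simp add: map_poly_pCons)
    show ?case
    proof (cases "c = 0")
      case True
      then have "poly (map_poly of_int q) a = 0" "q \<noteq> 0"
        using eq assms(2) pCons.prems(2) by auto
      then show ?thesis by (rule pCons.IH)
    next
      case False
      moreover have "a * poly (map_poly of_int q) a = of_int (- c)"
        using eq by (simp add: add_eq_0_iff)
      ultimately show ?thesis by (intro exI[of _ q] exI[of _ "- c"]) simp
    qed
  qed simp
  moreover obtain q :: "int poly" where "poly (map_poly of_int q) a = 0" "Polynomial.lead_coeff q = 1"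
    using assms(1) unfolding algebraic_int_altdef_ipoly by blast
  moreover have "q \<noteq> 0" using \<open>Polynomial.lead_coeff q = 1\<close> by auto
  ultimately obtain r :: "int poly" and c where c: "c \<noteq> 0" "a * poly (map_poly of_int r) a = of_int c"
    by blast
  \<comment> \<open>The sign factor makes the integer positive.\<close>
  have "a * poly (map_poly of_int (Polynomial.smult (sgn c) r)) a = of_int (sgn c * c)"
    using c(2) by (simp add: of_int_hom.map_poly_hom_smult mult.left_commute[of a])
  also have "sgn c * c = int (nat \<bar>c\<bar>)" by (simp add: sgn_if)
  finally have "a * poly (map_poly of_int (Polynomial.smult (sgn c) r)) a = of_nat (nat \<bar>c\<bar>)"
    by (simp only: of_int_of_nat_eq)
  moreover have "nat \<bar>c\<bar> > 0" using c(1) by simp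
  ultimately show ?thesis by blast
qed

lemma ideal_contains_of_nat:
  assumes "ideal I (ring_of_integers :: 'a::field_char_0 ring)" "I \<noteq> {0}"
  shows "\<exists>N>0. of_nat N \<in> I"
proof -
  obtain a where a: "a \<in> I" "a \<noteq> 0" using assms ideal_integersD(2) by blast
  then have alg: "algebraic_int a" using ideal_integersD(1)[OF assms(1)] by blast
  obtain r :: "int poly" and N where N: "N > 0" "a * poly (map_poly of_int r) a = of_nat N"
    using algebraic_int_dvd_of_nat[OF alg a(2)] by blast
  then show ?thesis
    using ideal_integersD(5)[OF assms(1) a(1) algebraic_int_poly_of_int[OF alg, of r]] by auto
qed

lemma covers_mod_pigeonhole:
  fixes u :: "nat \<Rightarrow> 'a::field_char_0" and A :: "'a set"
  assumes "covers_mod A N" "\<And>k. algebraic_int (u k)"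
  shows "\<exists>i j z. i < j \<and> algebraic_int z \<and> u j = u i + of_nat N * z"
proof -
  have "\<exists>x\<in>A. \<exists>z. algebraic_int z \<and> u k = x + of_nat N * z" for k
    using assms unfolding covers_mod_def by blast
  then obtain x z where xz: "\<And>k. x k \<in> A" "\<And>k. algebraic_int (z k)" "\<And>k. u k = x k + of_nat N * z k"
    by metis
  have "finite (range x)"
    using xz(1) assms(1) by (intro finite_subset[of "range x" A]) (auto simp: covers_mod_def)
  then have "\<not> inj x" using finite_imageD infinite_UNIV_nat by blast
  then obtain i j where ij: "i \<noteq> j" "x i = x j" unfolding inj_def by blast
  have *: "u b = u a + of_nat N * (z b - z a)" if "x a = x b" for a b
    unfolding xz(3) that by (simp add: algebra_simps)
  show ?thesis
  proof (cases "i < j")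
    case True
    then show ?thesis using *[OF ij(2)] algebraic_int_diff[OF xz(2) xz(2)] by blast
  next
    case False
    then have "j < i" using ij by simp
    then show ?thesis using *[OF ij(2)[symmetric]] algebraic_int_diff[OF xz(2) xz(2)] by blast
  qed
qed

text \<open>An ideal containing \<open>N\<close> is determined by which of the finitely many
  representatives modulo \<open>N\<close> it contains. This yields maximal elements in families of
  ideals without the Noetherian property.\<close>

lemma finite_ideals_containing:
  assumes "number_field TYPE('a::field_char_0)" "N > 0"
  shows "finite {I. ideal I (ring_of_integers :: 'a ring) \<and> of_nat N \<in> I}"
proof -
  obtain A :: "'a set" where A: "covers_mod A N" using covers_mod_exists[OF assms] by blast
  have sub: "I \<subseteq> J"
    if I: "ideal I (ring_of_integers :: 'a ring)" "of_nat N \<in> I"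
      and J: "ideal J (ring_of_integers :: 'a ring)" "of_nat N \<in> J" and eq: "I \<inter> A = J \<inter> A" for I J
  proof
    fix y assume y: "y \<in> I"
    then obtain x z where x: "x \<in> A" "algebraic_int z" "y = x + of_nat N * z"
      using A ideal_integersD(1)[OF I(1)] unfolding covers_mod_def by blast
    have "y - of_nat N * z \<in> I"
      using ideal_integersD(5,7)[OF I(1)] I(2) x(2) y by blast
    then have "x \<in> J" using x eq by auto
    then show "y \<in> J"
      unfolding x(3) using ideal_integersD(3,5)[OF J(1)] J(2) x(2) by blast
  qed
  have "inj_on (\<lambda>I. I \<inter> A) {I. ideal I (ring_of_integers :: 'a ring) \<and> of_nat N \<in> I}"
    using sub by (intro inj_onI equalityI) blast+
  moreover have "(\<lambda>I. I \<inter> A) ` {I. ideal I (ring_of_integers :: 'a ring) \<and> of_nat N \<in> I} \<subseteq> Pow A" by blast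
  moreover have "finite (Pow A)" using A by (simp add: covers_mod_def)
  ultimately show ?thesis using inj_on_finite by blast
qed

section \<open>Colon ideals, maximality of nonzero primes, and local inverses\<close>

definition colon :: "'a::field_char_0 set \<Rightarrow> 'a \<Rightarrow> 'a set" where
  "colon I b = {a. algebraic_int a \<and> a * b \<in> I}"

lemma colon_ideal:
  assumes "ideal I (ring_of_integers :: 'a::field_char_0 ring)" "algebraic_int b"
  shows "ideal (colon I b) ring_of_integers" "I \<subseteq> colon I b"
proof -
  show "ideal (colon I b) ring_of_integers"
    unfolding ideal_integers_iff colon_def
    using ideal_integersD(2-4)[OF assms(1)]
    by (simp add: distrib_right mult.assoc algebraic_int_add algebraic_int_mult)
  show "I \<subseteq> colon I b"
    unfolding colon_def using ideal_integersD(1,5)[OF assms(1)] assms(2) by blast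
qed

text \<open>A colon ideal \<open>(I : b)\<close> that is maximal among those disjoint from a multiplicative set is prime.\<close>

lemma prime_colon_exists:
  assumes "number_field TYPE('a::field_char_0)"
    and I: "ideal I (ring_of_integers :: 'a ring)" "I \<noteq> {0}"
    and S: "1 \<in> S" "\<And>s t. s \<in> S \<Longrightarrow> t \<in> S \<Longrightarrow> s * t \<in> S" "\<And>s. s \<in> S \<Longrightarrow> algebraic_int s" "I \<inter> S = {}"
  shows "\<exists>b. algebraic_int b \<and> primeideal (colon I b) ring_of_integers \<and> colon I b \<inter> S = {}"
proof -
  obtain N where N: "N > 0" "of_nat N \<in> I" using ideal_contains_of_nat[OF I] by blast
  define \<C> where "\<C> = {colon I b | b. algebraic_int b \<and> colon I b \<inter> S = {}}"
  have "\<C> \<subseteq> {J. ideal J ring_of_integers \<and> of_nat N \<in> J}"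
    unfolding \<C>_def using colon_ideal[OF I(1)] N by blast
  then have "finite \<C>" using finite_ideals_containing[OF assms(1) N(1)] finite_subset by blast
  moreover have "colon I 1 = I"
    using ideal_integersD(1)[OF I(1)] by (auto simp: colon_def)
  then have "I \<in> \<C>" unfolding \<C>_def using S(4) algebraic_int_1 by blast
  ultimately obtain Q where Q: "Q \<in> \<C>" and maxQ: "\<And>J. J \<in> \<C> \<Longrightarrow> Q \<subseteq> J \<Longrightarrow> Q = J"
    using finite_has_maximal[of \<C>] by blast
  then obtain b where b: "algebraic_int b" "Q = colon I b" "Q \<inter> S = {}" unfolding \<C>_def by blast
  have le: "colon I b \<subseteq> colon I (b * x)" if "algebraic_int x" for x
    using ideal_integersD(5)[OF I(1)] that unfolding colon_def by (auto simp: mult.assoc[symmetric])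
  have idQ: "ideal Q ring_of_integers" using colon_ideal[OF I(1) b(1)] b(2) by simp
  have "x \<in> Q \<or> y \<in> Q" if x: "algebraic_int x" and y: "algebraic_int y" and xy: "x * y \<in> Q" for x y
  proof (rule ccontr)
    assume neg: "\<not> (x \<in> Q \<or> y \<in> Q)"
    \<comment> \<open>Otherwise maximality gives \<open>Q = colon I (b * x)\<close>, which contains
      \<open>y\<close>.\<close>
    have "colon I (b * x) \<inter> S \<noteq> {}"
    proof
      assume "colon I (b * x) \<inter> S = {}"
      then have "colon I (b * x) \<in> \<C>" unfolding \<C>_def using algebraic_int_mult[OF b(1) x] by blast
      then have "Q = colon I (b * x)" using maxQ le[OF x] b(2) by blast
      moreover have "y \<in> colon I (b * x)"
        using xy y b(2) by (simp add: colon_def mult_ac)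
      ultimately show False using neg by blast
    qed
    then obtain s where s: "s \<in> S" "s * (b * x) \<in> I" by (auto simp: colon_def)
    \<comment> \<open>An element \<open>z\<close> of the intersection would put \<open>z * s\<close>
      into both \<open>Q\<close> and \<open>S\<close>. Then maximality gives
      \<open>Q = colon I (b * s)\<close>, and this contains \<open>x\<close> by the choice of
      \<open>s\<close>.\<close>
    have "colon I (b * s) \<inter> S = {}"
    proof (rule ccontr)
      assume "colon I (b * s) \<inter> S \<noteq> {}"
      then obtain z where z: "z \<in> S" "z * (b * s) \<in> I" by (auto simp: colon_def)
      then have "z * s \<in> Q \<inter> S"
        using S s(1) b(2) by (auto simp: colon_def mult_ac algebraic_int_mult)
      then show False using b(3) by blast
    qed
    then have "colon I (b * s) \<in> \<C>" unfolding \<C>_def using algebraic_int_mult[OF b(1) S(3)[OF s(1)]] by blast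
    then have "Q = colon I (b * s)" using maxQ le[OF S(3)[OF s(1)]] b(2) by blast
    moreover have "x \<in> colon I (b * s)" using s x by (simp add: colon_def mult_ac)
    ultimately show False using neg by blast
  qed
  moreover have "1 \<notin> Q" using b(3) S(1) by blast
  ultimately have "primeideal Q ring_of_integers" unfolding prime_integers_iff using idQ by blast
  then show ?thesis using b by blast
qed

lemma prime_of_integersD:
  assumes "prime_of_integers (P :: 'a::field_char_0 set)"
  shows "primeideal P ring_of_integers" "ideal P ring_of_integers" "P \<noteq> {0}" "1 \<notin> P"
    "algebraic_int a \<Longrightarrow> algebraic_int b \<Longrightarrow> a * b \<in> P \<Longrightarrow> a \<in> P \<or> b \<in> P"
  using assms unfolding prime_of_integers_def prime_integers_iff by auto

text \<open>Nonzero primes are maximal: two powers of \<open>a\<close> agree modulo an integer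
  \<open>N\<close> in \<open>P\<close>, so \<open>P\<close> contains
  \<open>a ^ i * (a * a ^ l - 1)\<close>. As no power of \<open>a\<close> lies in \<open>P\<close>,
  the class of \<open>a ^ l\<close> is the inverse.\<close>

lemma inverse_mod_prime:
  assumes "number_field TYPE('a::field_char_0)" "prime_of_integers (P :: 'a set)"
    "algebraic_int a" "a \<notin> P"
  shows "\<exists>b. algebraic_int b \<and> a * b - 1 \<in> P"
proof -
  note P = prime_of_integersD[OF assms(2)]
  obtain N where N: "N > 0" "of_nat N \<in> P" using ideal_contains_of_nat[OF P(2,3)] by blast
  obtain A :: "'a set" where "covers_mod A N" using covers_mod_exists[OF assms(1) N(1)] by blast
  from covers_mod_pigeonhole[OF this, of "\<lambda>k. a ^ k"] algebraic_int_power[OF assms(3)]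
  obtain i j z where ij: "i < j" "algebraic_int z" "a ^ j = a ^ i + of_nat N * z" by blast
  define l where "l = j - i - 1"
  have "j = i + Suc l" using ij(1) by (simp add: l_def)
  then have "a ^ i * (a * a ^ l - 1) = of_nat N * z"
    using ij(3) by (simp add: power_add algebra_simps)
  also have "\<dots> \<in> P" using ideal_integersD(5)[OF P(2) N(2) ij(2)] .
  finally have "a ^ i \<in> P \<or> a * a ^ l - 1 \<in> P"
    using assms(3) by (intro P(5)) (auto intro!: algebraic_int_diff algebraic_int_mult algebraic_int_power)
  then show ?thesis using prime_power_mem[OF P(1) assms(3)] assms(3,4) algebraic_int_power by blast
qed

text \<open>An element of \<open>P\<close> outside \<open>Q\<close> is invertible modulo
  \<open>Q\<close>, hence modulo \<open>P\<close>, which would put 1 into \<open>P\<close>.\<close>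

lemma prime_inclusion_eq:
  assumes "number_field TYPE('a::field_char_0)" "prime_of_integers (Q :: 'a set)" "prime_of_integers P" "Q \<subseteq> P"
  shows "Q = P"
proof (rule ccontr)
  note P = prime_of_integersD[OF assms(3)]
  assume "Q \<noteq> P"
  then obtain a where a: "a \<in> P" "a \<notin> Q" using assms(4) by blast
  then obtain b where b: "algebraic_int b" "a * b - 1 \<in> Q"
    using inverse_mod_prime[OF assms(1,2)] ideal_integersD(1)[OF P(2)] by blast
  then have "a * b - (a * b - 1) \<in> P"
    using ideal_integersD(5,7)[OF P(2)] a(1) assms(4) by blast
  then show False using P(4) by simp
qed

text \<open>
  If \<open>(N) \<subseteq> P\<close> and \<open>(N : b) = P\<close>, then \<open>\<gamma> = b / N\<close> satisfies \<open>\<gamma>P \<subseteq> \<O>\<close> and \<open>\<gamma> \<notin> \<O>\<close>. If moreover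
  \<open>\<gamma>P \<subseteq> P\<close>, then all \<open>N\<gamma>\<^sup>k\<close> are integral and two of them agree modulo \<open>N\<close>, so that \<open>\<gamma>\<close> is integral.
\<close>

lemma prime_inverse_exists:
  assumes nf: "number_field TYPE('a::field_char_0)" and "prime_of_integers (P :: 'a set)"
  shows "\<exists>\<gamma> t. (\<forall>a\<in>P. algebraic_int (\<gamma> * a)) \<and> t \<in> P \<and> \<gamma> * t - 1 \<in> P"
proof -
  note P = prime_of_integersD[OF assms(2)]
  note idP = ideal_integersD[OF P(2)]
  obtain N where N: "N > 0" "of_nat N \<in> P" using ideal_contains_of_nat[OF P(2,3)] by blast
  define I where "I = {of_nat N * z | z :: 'a. algebraic_int z}"
  have idI: "ideal I ring_of_integers"
    unfolding ideal_integers_iff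
  proof (intro conjI ballI allI impI)
    show "0 \<in> I" unfolding I_def by (auto intro: exI[of _ 0])
    fix x assume "x \<in> I"
    then obtain z where z: "x = of_nat N * z" "algebraic_int z" unfolding I_def by blast
    then show "algebraic_int x" by (auto intro: algebraic_int_mult)
    show "a * x \<in> I" if "algebraic_int a" for a
    proof -
      have "a * x = of_nat N * (a * z)" by (simp add: z(1) mult.left_commute)
      then show ?thesis using algebraic_int_mult[OF that z(2)] unfolding I_def by blast
    qed
    show "x + y \<in> I" if "y \<in> I" for y
    proof -
      obtain w where w: "y = of_nat N * w" "algebraic_int w" using \<open>y \<in> I\<close> unfolding I_def by blast
      then have "x + y = of_nat N * (z + w)" by (simp add: z(1) distrib_left)
      then show ?thesis using algebraic_int_add[OF z(2) w(2)] unfolding I_def by blast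
    qed
  qed
  have NI: "of_nat N \<in> I" unfolding I_def by (auto intro: exI[of _ 1])
  have IP: "I \<subseteq> P" unfolding I_def using idP(5)[OF N(2)] by blast
  \<comment> \<open>Avoiding the complement of \<open>P\<close> forces the prime colon ideal into
    \<open>P\<close>; being nonzero, it then equals \<open>P\<close>.\<close>
  define S where "S = {x. algebraic_int x} - P"
  have "\<exists>b. algebraic_int b \<and> primeideal (colon I b) ring_of_integers \<and> colon I b \<inter> S = {}"
  proof (rule prime_colon_exists[OF nf idI])
    show "I \<noteq> {0}" using NI N(1) by auto
    show "s * t \<in> S" if "s \<in> S" "t \<in> S" for s t
      using that P(5)[of s t] by (auto simp: S_def algebraic_int_mult)
    show "1 \<in> S" using P(4) by (simp add: S_def)
    show "algebraic_int s" if "s \<in> S" for s using that by (simp add: S_def)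
    show "I \<inter> S = {}" using IP unfolding S_def by blast
  qed
  then obtain b where b: "algebraic_int b" "primeideal (colon I b) ring_of_integers" "colon I b \<inter> S = {}"
    by blast
  have sub: "colon I b \<subseteq> P" using b(3) by (auto simp: S_def colon_def)
  have "of_nat N \<in> colon I b" using colon_ideal(2)[OF idI b(1)] NI by blast
  then have "prime_of_integers (colon I b)" using b(2) N(1) by (auto simp: prime_of_integers_def)
  from prime_inclusion_eq[OF nf this assms(2) sub] have PQ: "colon I b = P" .
  define \<gamma> where "\<gamma> = b / of_nat N"
  have N0: "(of_nat N :: 'a) \<noteq> 0" using N(1) by simp
  have \<gamma>P: "algebraic_int (\<gamma> * a)" if "a \<in> P" for a
  proof -
    have "a * b \<in> I" using that PQ by (auto simp: colon_def)
    then obtain z where "algebraic_int z" "a * b = of_nat N * z" by (auto simp: I_def)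
    then show ?thesis using N0 by (simp add: \<gamma>_def mult.commute)
  qed
  have \<gamma>: "\<not> algebraic_int \<gamma>"
  proof
    assume "algebraic_int \<gamma>"
    moreover have "1 * b = of_nat N * \<gamma>" using N0 by (simp add: \<gamma>_def)
    ultimately have "1 \<in> colon I b" unfolding colon_def I_def by (auto intro!: exI[of _ \<gamma>])
    then show False using PQ P(4) by simp
  qed
  have "\<exists>t\<in>P. \<gamma> * t \<notin> P"
  proof (rule ccontr)
    assume "\<not> ?thesis"
    then have stable: "\<gamma> * t \<in> P" if "t \<in> P" for t using that by blast
    have "\<gamma> ^ k * of_nat N \<in> P" for k
    proof (induction k)
      case (Suc k)
      then show ?case using stable[OF Suc] by (simp add: mult.assoc)
    qed (simp add: N(2))
    then have alg: "algebraic_int (\<gamma> ^ k * of_nat N)" for k using idP(1) by blast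
    obtain A :: "'a set" where "covers_mod A N" using covers_mod_exists[OF nf N(1)] by blast
    from covers_mod_pigeonhole[OF this, of "\<lambda>k. \<gamma> ^ k * of_nat N", OF alg]
    obtain i j z where ij: "i < j" "algebraic_int z" "\<gamma> ^ j * of_nat N = \<gamma> ^ i * of_nat N + of_nat N * z"
      by blast
    have "of_nat N * \<gamma> ^ j = of_nat N * (\<gamma> ^ i + z)"
      using ij(3) by (simp only: distrib_left mult.commute)
    then have "\<gamma> ^ j = \<gamma> ^ i + z" using N0 by simp
    \<comment> \<open>The coefficients are a sum of two deltas because for \<open>i = 0\<close> both
      terms belong to the same power.\<close>
    also have "\<dots> = (\<Sum>l<j. ((if l = i then 1 else 0) + (if l = 0 then z else 0)) * \<gamma> ^ l)"
      using ij(1) by (simp add: distrib_right sum.distrib if_distrib[of "\<lambda>x. x * _"] cong: if_cong)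
    finally have "algebraic_int \<gamma>"
      by (rule algebraic_int_integral) (simp add: ij(2) algebraic_int_add)
    then show False using \<gamma> by blast
  qed
  then obtain t where t: "t \<in> P" "\<gamma> * t \<notin> P" by blast
  \<comment> \<open>The element \<open>\<gamma> * t\<close> is only a unit modulo \<open>P\<close>;
    replacing \<open>t\<close> by \<open>t * s\<close> normalises the unit to 1.\<close>
  then obtain s where s: "algebraic_int s" "(\<gamma> * t) * s - 1 \<in> P"
    using inverse_mod_prime[OF nf assms(2) \<gamma>P] by blast
  have "t * s \<in> P" using idP(5)[OF t(1) s(1)] .
  moreover have "\<gamma> * (t * s) - 1 \<in> P" using s(2) by (simp only: mult.assoc)
  ultimately show ?thesis using \<gamma>P by blast
qed

section \<open>Divisibility and residue arithmetic at a single prime\<close>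

lemma (in ring) card_carrier_eq_subfield_power:
  assumes K: "subfield K R" and fin: "finite (carrier R)"
  shows "card (carrier R) = card K ^ dim K (carrier R)"
proof -
  have KR: "K \<subseteq> carrier R" using subfieldE(3)[OF K] .
  obtain Us where Us: "set Us = carrier R" using finite_list[OF fin] by blast
  have "Span K Us = carrier R"
    using Span_in_carrier[OF KR, of Us] Span_base_incl[OF K, of Us] Us by auto
  then have "finite_dimension K (carrier R)"
    using Span_finite_dimension[OF K, of Us] Us by simp
  from finite_dimensionE[OF K this] obtain Vs where Vs: "independent K Vs"
      "length Vs = dim K (carrier R)" "Span K Vs = carrier R"
    using exists_base[OF K] unfolding over_def by metis
  define W where "W = {Ks. set Ks \<subseteq> K \<and> length Ks = length Vs}"
  \<comment> \<open>Coordinates with respect to the basis \<open>Vs\<close> identify the ring with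
    the lists of scalars of fixed length.\<close>
  have "bij_betw (\<lambda>Ks. combine Ks Vs) W (carrier R)"
  proof (rule bij_betw_imageI)
    have in_span: "combine Ks Vs \<in> carrier R" if "Ks \<in> W" for Ks
      using combine_in_carrier[of Ks Vs] that KR independent_in_carrier[OF Vs(1)] by (auto simp: W_def)
    show "inj_on (\<lambda>Ks. combine Ks Vs) W"
    proof (rule inj_onI)
      fix Ks Ls assume *: "Ks \<in> W" "Ls \<in> W" "combine Ks Vs = combine Ls Vs"
      have "combine Ks Vs \<in> Span K Vs" using in_span[OF *(1)] Vs(3) by blast
      from unique_decomposition[OF K Vs(1) this] show "Ks = Ls"
        using * unfolding W_def by blast
    qed
    have "a \<in> (\<lambda>Ks. combine Ks Vs) ` W" if "a \<in> carrier R" for a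
      using unique_decomposition[OF K Vs(1), of a] that Vs(3) unfolding W_def by blast
    then show "(\<lambda>Ks. combine Ks Vs) ` W = carrier R" using in_span by blast
  qed
  then have "card (carrier R) = card W" by (simp add: bij_betw_same_card)
  also have "\<dots> = card K ^ length Vs"
    unfolding W_def by (rule card_lists_length_eq) (use finite_subset[OF KR fin] in simp)
  finally show ?thesis using Vs(2) by simp
qed

text \<open>Locally at \<open>P\<close>, \<open>t\<close> is a uniformizer and
  \<open>\<gamma>\<close> is inverse to it up to a unit congruent to 1. Multiplication by
  \<open>\<gamma>\<close> therefore tests membership in \<open>P\<close> and in its square without
  localising.\<close>

locale inverted_prime =
  fixes P :: "'a::field_char_0 set" and \<gamma> t :: 'a
  assumes nf: "number_field TYPE('a)"
    and prime: "prime_of_integers P"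
    and inverse_mult: "a \<in> P \<Longrightarrow> algebraic_int (\<gamma> * a)"
    and t_mem: "t \<in> P"
    and inverse_mult_t: "\<gamma> * t - 1 \<in> P"
begin

lemmas P = prime_of_integersD[OF prime]
lemmas idP = ideal_integersD[OF P(2)]

text \<open>For the nontrivial direction,
  \<open>a = t * (\<gamma> * a) - (\<gamma> * t - 1) * a\<close>, and both terms lie in
  \<open>P\<close>.\<close>

lemma mem_iff: "a \<in> P \<longleftrightarrow> algebraic_int a \<and> algebraic_int (\<gamma> * a)"
proof
  assume a: "algebraic_int a \<and> algebraic_int (\<gamma> * a)"
  have "t * (\<gamma> * a) - (\<gamma> * t - 1) * a \<in> P"
    using a t_mem inverse_mult_t idP(5,7) by blast
  then show "a \<in> P" by (simp add: algebra_simps)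
qed (use idP(1) inverse_mult in blast)

lemma inverse_not_integral: "\<not> algebraic_int \<gamma>"
  using mem_iff[of 1] P(4) by simp

text \<open>The decomposition \<open>a = t * (\<gamma> * a) + (1 - \<gamma> * t) * a\<close>
  exhibits \<open>a\<close> as a sum of two products of elements of \<open>P\<close>.\<close>

lemma square_iff: "a \<in> ideal_square P \<longleftrightarrow> a \<in> P \<and> \<gamma> * a \<in> P"
proof
  assume "a \<in> ideal_square P"
  then show "a \<in> P \<and> \<gamma> * a \<in> P"
    unfolding ideal_square_def
  proof (induction rule: ideal_prod.induct)
    case (prod i j)
    then have "\<gamma> * i * j \<in> P" "i * j \<in> P"
      using inverse_mult[of i] idP(1)[of i] idP(4)[of j] by blast+
    then show ?case by (simp add: mult.assoc)
  next
    case (sum a b)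
    then show ?case using idP(3)[of a b] idP(3)[of "\<gamma> * a" "\<gamma> * b"] by (simp add: distrib_left)
  qed
next
  assume a: "a \<in> P \<and> \<gamma> * a \<in> P"
  have "1 - \<gamma> * t \<in> P" using idP(6)[OF inverse_mult_t] by simp
  then have "t * (\<gamma> * a) + (1 - \<gamma> * t) * a \<in> ideal_square P"
    using ideal_prod.sum[OF ideal_prod.prod ideal_prod.prod, of t P "\<gamma> * a" P "1 - \<gamma> * t" a ring_of_integers]
      a t_mem by (simp add: ideal_square_def)
  then show "a \<in> ideal_square P" by (simp add: algebra_simps)
qed

text \<open>For an ideal \<open>J\<close> inside \<open>P\<close> this is the product of
  \<open>J\<close> with the inverse fractional ideal of \<open>P\<close>, which is generated by 1
  and \<open>\<gamma>\<close>.\<close>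

definition cofactor :: "'a set \<Rightarrow> 'a set" where
  "cofactor J = {\<gamma> * x + y | x y. x \<in> J \<and> y \<in> J}"

lemma cofactor_ideal:
  assumes J: "ideal J ring_of_integers" "J \<subseteq> P"
  shows "ideal (cofactor J) ring_of_integers"
  unfolding ideal_integers_iff
proof (intro conjI ballI allI impI)
  note idJ = ideal_integersD[OF J(1)]
  show "0 \<in> cofactor J"
    unfolding cofactor_def using idJ(2) by (intro CollectI exI[of _ 0]) simp
  fix z assume "z \<in> cofactor J"
  then obtain x y where z: "z = \<gamma> * x + y" "x \<in> J" "y \<in> J" unfolding cofactor_def by blast
  show "algebraic_int z"
    unfolding z(1) using z J inverse_mult[of x] idJ(1)[of y] by (intro algebraic_int_add) auto
  show "a * z \<in> cofactor J" if "algebraic_int a" for a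
  proof -
    have "a * z = \<gamma> * (a * x) + a * y" by (simp add: z(1) algebra_simps)
    then show ?thesis unfolding cofactor_def using idJ(4)[OF z(2) that] idJ(4)[OF z(3) that] by blast
  qed
  show "z + z' \<in> cofactor J" if z': "z' \<in> cofactor J" for z'
  proof -
    obtain x' y' where z': "z' = \<gamma> * x' + y'" "x' \<in> J" "y' \<in> J" using z' unfolding cofactor_def by blast
    have "z + z' = \<gamma> * (x + x') + (y + y')" by (simp add: z(1) z'(1) algebra_simps)
    then show ?thesis unfolding cofactor_def using idJ(3)[OF z(2) z'(2)] idJ(3)[OF z(3) z'(3)] by blast
  qed
qed

lemma prod_cofactor:
  assumes J: "ideal J ring_of_integers" "J \<subseteq> P"
  shows "P \<cdot>\<^bsub>ring_of_integers\<^esub> cofactor J = J"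
proof
  note idJ = ideal_integersD[OF J(1)]
  show "P \<cdot>\<^bsub>ring_of_integers\<^esub> cofactor J \<subseteq> J"
  proof
    fix z assume "z \<in> P \<cdot>\<^bsub>ring_of_integers\<^esub> cofactor J"
    then show "z \<in> J"
    proof (induction rule: ideal_prod.induct)
      case (prod i j)
      then obtain x y where j: "j = \<gamma> * x + y" "x \<in> J" "y \<in> J" unfolding cofactor_def by blast
      have "i * j = (\<gamma> * i) * x + i * y" by (simp add: j(1) algebra_simps)
      then show ?case
        using idJ(3) idJ(4)[OF j(2) inverse_mult[OF prod(1)]] idJ(4)[OF j(3) idP(1)[OF prod(1)]] by simp
    next
      case (sum a b)
      then show ?case using idJ(3)[of a b] by simp
    qed
  qed
  show "J \<subseteq> P \<cdot>\<^bsub>ring_of_integers\<^esub> cofactor J"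
  proof
    fix z assume z: "z \<in> J"
    have "1 - \<gamma> * t \<in> P" using idP(6)[OF inverse_mult_t] by simp
    moreover have "\<gamma> * z + 0 \<in> cofactor J" "\<gamma> * 0 + z \<in> cofactor J"
      unfolding cofactor_def using z idJ(2) by blast+
    ultimately have "t * (\<gamma> * z + 0) + (1 - \<gamma> * t) * (\<gamma> * 0 + z) \<in> P \<cdot>\<^bsub>ring_of_integers\<^esub> cofactor J"
      using ideal_prod.sum[OF ideal_prod.prod ideal_prod.prod, of t P "\<gamma> * z + 0" "cofactor J"
          "1 - \<gamma> * t" "\<gamma> * 0 + z" ring_of_integers] t_mem by simp
    then show "z \<in> P \<cdot>\<^bsub>ring_of_integers\<^esub> cofactor J" by (simp add: algebra_simps)
  qed
qed

text \<open>To contain is to divide: \<open>cofactor\<close> supplies the complementary ideal, once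
  for \<open>P\<close> and twice for its square.\<close>

lemma ideal_divides_principal_iff:
  assumes a: "algebraic_int a"
  shows "ideal_divides P (PIdl\<^bsub>ring_of_integers\<^esub> a) \<longleftrightarrow> a \<in> P"
    and "ideal_divides (ideal_square P) (PIdl\<^bsub>ring_of_integers\<^esub> a) \<longleftrightarrow> a \<in> ideal_square P"
proof -
  interpret O: cring "ring_of_integers :: 'a ring" by (rule cring_ring_of_integers)
  define J where "J = PIdl\<^bsub>ring_of_integers\<^esub> a"
  have J: "ideal J ring_of_integers" "a \<in> J"
    using O.cgenideal_ideal[of a] O.cgenideal_self[of a] a unfolding J_def by auto
  have J_eq: "J = {x * a | x. algebraic_int x}" by (simp add: J_def cgenideal_def)
  have mem: "a \<in> I" if "ideal_divides I J" "ideal I ring_of_integers" for I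
    using that J(2) O.ideal_prod_inter unfolding ideal_divides_def by blast
  have sq: "ideal (ideal_square P) ring_of_integers"
    unfolding ideal_square_def by (rule O.ideal_prod_is_ideal[OF P(2) P(2)])
  have sub: "J \<subseteq> P" if "a \<in> P" unfolding J_eq using idP(4)[OF that] by blast
  have "ideal_divides P J" if "a \<in> P"
    unfolding ideal_divides_def using prod_cofactor[OF J(1) sub[OF that]] cofactor_ideal[OF J(1) sub[OF that]] by metis
  then show "ideal_divides P (PIdl\<^bsub>ring_of_integers\<^esub> a) \<longleftrightarrow> a \<in> P"
    using mem[OF _ P(2)] unfolding J_def by blast
  have "ideal_divides (ideal_square P) J" if "a \<in> ideal_square P"
  proof -
    have aP: "a \<in> P" "\<gamma> * a \<in> P" using that square_iff by blast+
    note JP = sub[OF aP(1)]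
    define C where "C = cofactor J"
    have C: "ideal C ring_of_integers" "P \<cdot>\<^bsub>ring_of_integers\<^esub> C = J"
      unfolding C_def by (rule cofactor_ideal[OF J(1) JP], rule prod_cofactor[OF J(1) JP])
    \<comment> \<open>Since \<open>\<gamma> * a\<close> is in \<open>P\<close>, the quotient ideal
      \<open>C\<close> still lies in \<open>P\<close>, so a second factor \<open>P\<close> can be
      split off.\<close>
    have "C \<subseteq> P"
    proof
      fix z assume "z \<in> C"
      then obtain x y where z: "z = \<gamma> * (x * a) + y" "algebraic_int x" "y \<in> J"
        unfolding C_def cofactor_def J_eq by blast
      have "x * (\<gamma> * a) + y \<in> P" using idP(3)[OF idP(4)[OF aP(2) z(2)]] z(3) JP by blast
      then show "z \<in> P" by (simp add: z(1) mult.left_commute)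
    qed
    note CP = C(1) this
    have "P \<cdot>\<^bsub>ring_of_integers\<^esub> P \<cdot>\<^bsub>ring_of_integers\<^esub> cofactor C = J"
      using O.ideal_prod_assoc[OF P(2) P(2) cofactor_ideal[OF CP]] prod_cofactor[OF CP] C(2) by simp
    then show ?thesis
      unfolding ideal_divides_def ideal_square_def using cofactor_ideal[OF CP] by metis
  qed
  then show "ideal_divides (ideal_square P) (PIdl\<^bsub>ring_of_integers\<^esub> a) \<longleftrightarrow> a \<in> ideal_square P"
    using mem[OF _ sq] unfolding J_def by blast
qed

section \<open>The residue field, its prime field and its order\<close>

abbreviation residue :: "'a \<Rightarrow> 'a set" where
  "residue a \<equiv> P +>\<^bsub>ring_of_integers\<^esub> a"

lemma residue_eq_iff:
  assumes "algebraic_int a" "algebraic_int b"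
  shows "residue a = residue b \<longleftrightarrow> a - b \<in> P"
proof -
  have coset: "residue a = {h + a | h. h \<in> P}" for a
    unfolding a_r_coset_def' by auto
  show ?thesis
  proof
    assume "residue a = residue b"
    moreover have "0 + a \<in> residue a" unfolding coset using idP(2) by blast
    ultimately obtain h where "h \<in> P" "a = h + b" unfolding coset by auto
    then show "a - b \<in> P" by simp
  next
    have *: "residue a \<subseteq> residue b" if ab: "a - b \<in> P" for a b
    proof
      fix z assume "z \<in> residue a"
      then obtain h where "h \<in> P" "z = h + a" unfolding coset by blast
      then have "h + (a - b) \<in> P" "z = (h + (a - b)) + b" using idP(3)[OF _ ab] by auto
      then show "z \<in> residue b" unfolding coset by blast
    qed
    assume "a - b \<in> P"
    moreover have "b - a \<in> P" using idP(6)[OF \<open>a - b \<in> P\<close>] by simp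
    ultimately show "residue a = residue b" using * by blast
  qed
qed

lemma residue_hom:
  "algebraic_int a \<Longrightarrow> residue a \<in> carrier (residue_field P)"
  "algebraic_int a \<Longrightarrow> algebraic_int b \<Longrightarrow> residue (a * b) = residue a \<otimes>\<^bsub>residue_field P\<^esub> residue b"
  "algebraic_int a \<Longrightarrow> algebraic_int b \<Longrightarrow> residue (a + b) = residue a \<oplus>\<^bsub>residue_field P\<^esub> residue b"
  "residue 1 = \<one>\<^bsub>residue_field P\<^esub>"
  using ideal.rcos_ring_hom[OF P(2)] unfolding Ring.ring_hom_def residue_field_def by auto

lemma residue_surj:
  assumes "x \<in> carrier (residue_field P)"
  obtains a where "algebraic_int a" "x = residue a"
  using assms unfolding residue_field_def by (auto simp: FactRing_def A_RCOSETS_def')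

lemma residue_0: "residue 0 = \<zero>\<^bsub>residue_field P\<^esub>"
  using residue_hom(3)[of 0 0] residue_hom(1)[of 0] ideal.quotient_is_ring[OF P(2)]
  unfolding residue_field_def by (metis add_0 algebraic_int_0 ring.ring_simprules(8) ring.is_abelian_group
      abelian_group.minus_equality abelian_group.r_neg1 abelian_group.r_neg2 abelian_group.a_inv_closed abelian_group.r_neg)

lemma field_residue_field: "field (residue_field P)"
proof -
  interpret F: domain "residue_field P"
    unfolding residue_field_def by (rule primeideal.quotient_is_domain[OF P(1)])
  have "\<exists>y\<in>carrier (residue_field P). x \<otimes>\<^bsub>residue_field P\<^esub> y = \<one>\<^bsub>residue_field P\<^esub>"
    if x: "x \<in> carrier (residue_field P)" "x \<noteq> \<zero>\<^bsub>residue_field P\<^esub>" for x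
  proof -
    obtain a where a: "algebraic_int a" "x = residue a" using x(1) by (rule residue_surj)
    then have "a \<notin> P" using x(2) residue_0 residue_eq_iff[of a 0] by auto
    then obtain b where b: "algebraic_int b" "a * b - 1 \<in> P" using inverse_mod_prime[OF nf prime a(1)] by blast
    then have "residue (a * b) = residue 1"
      using a(1) by (subst residue_eq_iff) (auto simp: algebraic_int_mult)
    then show ?thesis using a b residue_hom by auto
  qed
  then show ?thesis
    by (intro F.cring_fieldI2 F.zero_not_one) auto
qed

lemma finite_residue_field: "finite (carrier (residue_field P))"
proof -
  obtain N where N: "N > 0" "of_nat N \<in> P" using ideal_contains_of_nat[OF P(2,3)] by blast
  obtain A :: "'a set" where A: "covers_mod A N" using covers_mod_exists[OF nf N(1)] by blast
  have "carrier (residue_field P) \<subseteq> residue ` A"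
  proof
    fix x assume "x \<in> carrier (residue_field P)"
    then obtain a where a: "algebraic_int a" "x = residue a" by (rule residue_surj)
    then obtain y z where y: "y \<in> A" "algebraic_int y" "algebraic_int z" "a = y + of_nat N * z"
      using A unfolding covers_mod_def by blast
    then have "a - y \<in> P" using idP(5)[OF N(2) y(3)] by simp
    then show "x \<in> residue ` A" using residue_eq_iff[OF a(1) y(2)] a(2) y(1) by blast
  qed
  then show ?thesis using A finite_subset unfolding covers_mod_def by blast
qed

lemma residue_char_dvd_iff: "residue_char P dvd k \<longleftrightarrow> of_nat k \<in> P"
proof -
  interpret F: field "residue_field P" by (rule field_residue_field)
  have "[k] \<cdot>\<^bsub>residue_field P\<^esub> \<one>\<^bsub>residue_field P\<^esub> = residue (of_nat k)" for k :: nat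
  proof (induction k)
    case (Suc k)
    then show ?case using residue_hom(3)[of "of_nat k" 1] residue_hom(4) by (simp add: add.commute)
  qed (simp add: residue_0)
  then have "\<one>\<^bsub>residue_field P\<^esub> [^]\<^bsub>add_monoid (residue_field P)\<^esub> k = residue (of_nat k)" for k :: nat
    by (simp add: add_pow_def)
  then have "residue_char P dvd k \<longleftrightarrow> residue (of_nat k) = residue 0"
    unfolding residue_char_def using group.pow_eq_id[OF F.add.is_group, of "\<one>\<^bsub>residue_field P\<^esub>" k] residue_0 by simp
  then show ?thesis using residue_eq_iff[of "of_nat k" 0] by simp
qed

lemma prime_residue_char: "Factorial_Ring.prime (residue_char P)"
proof -
  obtain N where N: "N > 0" "of_nat N \<in> P" using ideal_contains_of_nat[OF P(2,3)] by blast
  have "residue_char P \<noteq> 0" using residue_char_dvd_iff[of N] N by auto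
  moreover have "\<not> residue_char P dvd 1" using residue_char_dvd_iff[of 1] P(4) by simp
  moreover have "residue_char P dvd a \<or> residue_char P dvd b" if "residue_char P dvd a * b" for a b
    using that P(5)[of "of_nat a" "of_nat b"] by (simp add: residue_char_dvd_iff)
  ultimately have "Factorial_Ring.prime_elem (residue_char P)"
    unfolding Factorial_Ring.prime_elem_def by blast
  then show ?thesis by simp
qed

text \<open>The classes of \<open>0, ..., p - 1\<close> are already closed under the field
  operations; reciprocals come from inverses of integers modulo \<open>p\<close>.\<close>

lemma prime_subfield:
  "generate_field (residue_field P) {} = (\<lambda>k. residue (of_nat k)) ` {0..<residue_char P}"
    (is "?K = ?S")
proof -
  let ?p = "residue_char P"
  interpret F: field "residue_field P" by (rule field_residue_field)
  have p: "?p > 0" using prime_residue_char prime_gt_0_nat by blast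
  have reduce: "residue (of_nat k) \<in> ?S" for k
  proof -
    have "k = k mod ?p + ?p * (k div ?p)" by simp
    then have "(of_nat k :: 'a) - of_nat (k mod ?p) = of_nat (?p * (k div ?p))"
      by (metis add_diff_cancel_left' of_nat_add)
    then have "(of_nat k :: 'a) - of_nat (k mod ?p) \<in> P"
      using residue_char_dvd_iff[of "?p * (k div ?p)"] by simp
    then have "residue (of_nat k) = residue (of_nat (k mod ?p))" by (simp add: residue_eq_iff)
    then show ?thesis using p by auto
  qed
  have "x \<in> ?S" if "x \<in> ?K" for x
    using that
  proof (induction rule: generate_field.induct)
    case one
    then show ?case using reduce[of 1] residue_hom(4) by simp
  next
    case (a_inv h)
    then obtain k where k: "h = residue (of_nat k)" by blast
    \<comment> \<open>The class of \<open>(p - 1) * k\<close> is the negative of that of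
      \<open>k\<close>; this form keeps the representative a natural number.\<close>
    have "?p dvd (?p - 1) * k + k" using p by (metis Suc_diff_1 add.commute dvd_triv_left mult_Suc)
    then have "residue (of_nat ((?p - 1) * k + k)) = residue 0"
      using residue_char_dvd_iff[of "(?p - 1) * k + k"] residue_eq_iff[of "of_nat ((?p - 1) * k + k)" 0]
      by (simp del: of_nat_add of_nat_mult)
    then have "residue (of_nat ((?p - 1) * k)) \<oplus>\<^bsub>residue_field P\<^esub> h = \<zero>\<^bsub>residue_field P\<^esub>"
      unfolding k residue_0[symmetric] of_nat_add
      by (subst residue_hom(3)[symmetric]) (auto simp del: of_nat_mult)
    then have "\<ominus>\<^bsub>residue_field P\<^esub> h = residue (of_nat ((?p - 1) * k))"
      using F.minus_equality residue_hom(1) k algebraic_int_of_nat by blast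
    then show ?case using reduce by (simp del: of_nat_mult)
  next
    case (m_inv h)
    then obtain k where k: "h = residue (of_nat k)" by blast
    have "\<not> ?p dvd k"
      using m_inv(2) k residue_0 residue_char_dvd_iff[of k] residue_eq_iff[of "of_nat k" 0] by auto
    then have "coprime k ?p"
      using prime_residue_char prime_imp_coprime[of ?p k] by (simp add: coprime_commute)
    then obtain l where "[k * l = 1] (mod ?p)" using cong_solve_coprime_nat[of k ?p] by auto
    then have "[int (k * l) = int 1] (mod int ?p)" by (simp only: cong_int_iff)
    then have "int ?p dvd int (k * l) - 1" by (simp add: cong_iff_dvd_diff)
    then obtain w where w: "int (k * l) - 1 = int ?p * w" by (rule dvdE)
    have "(of_nat (k * l) - 1 :: 'a) = of_int (int (k * l) - 1)" by simp
    also have "\<dots> = of_nat ?p * of_int w" unfolding w by simp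
    also have "\<dots> \<in> P" using residue_char_dvd_iff[of ?p] by (intro idP(5)) auto
    finally have "residue (of_nat (k * l)) = residue 1" by (subst residue_eq_iff) (auto simp del: of_nat_mult)
    then have kl: "residue (of_nat k) \<otimes>\<^bsub>residue_field P\<^esub> residue (of_nat l) = \<one>\<^bsub>residue_field P\<^esub>"
      using residue_hom(2)[of "of_nat k" "of_nat l"] residue_hom(4) by simp
    have "inv\<^bsub>residue_field P\<^esub> h = residue (of_nat l)"
      unfolding k using F.comm_inv_char[OF _ _ kl] residue_hom(1) by simp
    then show ?case using reduce by simp
  next
    case (eng_add h1 h2)
    then obtain k l where "h1 = residue (of_nat k)" "h2 = residue (of_nat l)" by blast
    then show ?case using reduce[of "k + l"] residue_hom(3)[of "of_nat k" "of_nat l"] by simp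
  next
    case (eng_mult h1 h2)
    then obtain k l where "h1 = residue (of_nat k)" "h2 = residue (of_nat l)" by blast
    then show ?case using reduce[of "k * l"] residue_hom(2)[of "of_nat k" "of_nat l"] by simp
  qed simp
  moreover have "residue (of_nat k) \<in> ?K" for k
  proof (induction k)
    case 0
    then show ?case using F.zero_in_generate residue_0 by simp
  next
    case (Suc k)
    then show ?case
      using generate_field.eng_add[OF generate_field.one Suc] residue_hom(3)[of 1 "of_nat k"] residue_hom(4) by simp
  qed
  ultimately show ?thesis by blast
qed

lemma card_residue_field: "card (carrier (residue_field P)) = residue_char P ^ residue_degree P"
proof -
  interpret F: field "residue_field P" by (rule field_residue_field)
  have "inj_on (\<lambda>k. residue (of_nat k)) {0..<residue_char P}"
  proof (rule linorder_inj_onI)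
    fix k l assume kl: "k < l" "k \<in> {0..<residue_char P}" "l \<in> {0..<residue_char P}"
    show "residue (of_nat k) \<noteq> residue (of_nat l)"
    proof
      assume "residue (of_nat k) = residue (of_nat l)"
      then have "of_nat l - of_nat k \<in> P" using residue_eq_iff[of "of_nat l" "of_nat k"] by simp
      then have "of_nat (l - k) \<in> P" using kl(1) by (simp add: of_nat_diff)
      then have "residue_char P dvd l - k" by (simp add: residue_char_dvd_iff)
      then show False using kl dvd_imp_le[of "residue_char P" "l - k"] by auto
    qed
  qed auto
  then have "card (generate_field (residue_field P) {}) = residue_char P"
    unfolding prime_subfield by (simp add: card_image)
  moreover have "subfield (generate_field (residue_field P) {}) (residue_field P)"
    by (rule F.generate_field_is_subfield) simp
  ultimately show ?thesis
    using F.card_carrier_eq_subfield_power[OF _ finite_residue_field] unfolding residue_degree_def by metis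
qed

lemma residue_degree_pos: "residue_degree P > 0"
proof (rule ccontr)
  assume "\<not> ?thesis"
  then have "card (carrier (residue_field P)) = 1" using card_residue_field by simp
  then obtain x where "carrier (residue_field P) = {x}" by (auto simp: card_1_singleton_iff)
  then have "residue 1 = residue 0" using residue_hom(1)[of 1] residue_hom(1)[of 0] by simp
  then show False using residue_eq_iff[of 1 0] P(4) by simp
qed

lemma residue_pow:
  "algebraic_int a \<Longrightarrow> residue (a ^ k) = residue a [^]\<^bsub>residue_field P\<^esub> (k::nat)"
proof (induction k)
  case 0
  interpret F: field "residue_field P" by (rule field_residue_field)
  show ?case using residue_hom(4) by simp
next
  case (Suc k)
  interpret F: field "residue_field P" by (rule field_residue_field)
  have "residue (a ^ k * a) = residue a [^]\<^bsub>residue_field P\<^esub> k \<otimes>\<^bsub>residue_field P\<^esub> residue a"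
    using Suc residue_hom(2)[OF algebraic_int_power[of a k], of a] by simp
  then show ?case by (simp add: mult.commute)
qed

text \<open>Lagrange's theorem in the multiplicative group of the residue field.\<close>

lemma fermat_nonzero:
  assumes "algebraic_int a" "a \<notin> P"
  shows "a ^ (residue_char P ^ residue_degree P - 1) - 1 \<in> P"
proof -
  interpret F: field "residue_field P" by (rule field_residue_field)
  interpret M: group "Multiplicative_Group.mult_of (residue_field P)" by (rule F.field_mult_group)
  have "residue a \<noteq> \<zero>\<^bsub>residue_field P\<^esub>" using assms residue_0 residue_eq_iff[of a 0] by auto
  then have "residue a \<in> carrier (Multiplicative_Group.mult_of (residue_field P))" using residue_hom(1)[OF assms(1)] by simp
  moreover have "Coset.order (Multiplicative_Group.mult_of (residue_field P)) = residue_char P ^ residue_degree P - 1"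
    unfolding F.order_mult_of[OF finite_residue_field] unfolding Coset.order_def card_residue_field ..
  ultimately have "residue a [^]\<^bsub>residue_field P\<^esub> (residue_char P ^ residue_degree P - 1) = \<one>\<^bsub>residue_field P\<^esub>"
    using M.pow_order_eq_1[of "residue a"]
    by (simp only: Multiplicative_Group.nat_pow_mult_of Multiplicative_Group.one_mult_of)
  then have "residue (a ^ (residue_char P ^ residue_degree P - 1)) = residue 1"
    using residue_pow[OF assms(1)] residue_hom(4) by simp
  then show ?thesis
    using residue_eq_iff[of "a ^ (residue_char P ^ residue_degree P - 1)" 1] algebraic_int_power[OF assms(1)] by simp
qed

end

section \<open>The order generated by the radical\<close>

text \<open>The product \<open>k * (p ^ e choose k)\<close> is a multiple of \<open>p ^ e\<close>.
  Were the binomial coefficient prime to \<open>p\<close>, then \<open>p ^ e\<close> would divide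
  \<open>k\<close>, which is too small.\<close>

lemma prime_dvd_choose_power:
  assumes "Factorial_Ring.prime (p::nat)" "0 < k" "k < p ^ e"
  shows "p dvd (p ^ e choose k)"
proof (rule ccontr)
  assume "\<not> p dvd (p ^ e choose k)"
  then have "coprime (p ^ e) (p ^ e choose k)"
    using assms(1) by (intro coprime_power_left_iff[THEN iffD2] disjI1 prime_imp_coprime)
  moreover have "p ^ e dvd k * (p ^ e choose k)"
    using times_binomial_minus1_eq[OF assms(2), of "p ^ e"] by simp
  ultimately have "p ^ e dvd k" by (simp add: coprime_dvd_mult_left_iff)
  then show False using dvd_imp_le[of "p ^ e" k] assms(2,3) by simp
qed

text \<open>Frobenius additivity with an explicit error term. The factor \<open>a\<close> is pulled
  out of the error because for \<open>a = \<eta>\<close> the formula then becomes a relation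
  \<open>\<eta> ^ q = - \<eta> G - c\<close> with \<open>G\<close> divisible by
  \<open>p\<close>.\<close>

lemma binomial_prime_power:
  fixes a b :: "'a::comm_ring_1"
  assumes "Factorial_Ring.prime (p::nat)" "q = p ^ e"
  shows "(a + b) ^ q = a ^ q + b ^ q +
    a * (of_nat p * (\<Sum>k = 1..<q. of_nat ((q choose k) div p) * a ^ (k - 1) * b ^ (q - k)))"
proof -
  have q: "q > 0" using assms prime_gt_0_nat by simp
  have "(a + b) ^ q = (\<Sum>k\<le>q. of_nat (q choose k) * a ^ k * b ^ (q - k))"
    by (rule binomial_ring)
  also have "{..q} = {0, q} \<union> {1..<q}" using q by auto
  also have "(\<Sum>k\<in>\<dots>. of_nat (q choose k) * a ^ k * b ^ (q - k)) =
      (\<Sum>k\<in>{0, q}. of_nat (q choose k) * a ^ k * b ^ (q - k)) +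
      (\<Sum>k = 1..<q. of_nat (q choose k) * a ^ k * b ^ (q - k))"
    by (rule sum.union_disjoint) auto
  also have "(\<Sum>k\<in>{0, q}. of_nat (q choose k) * a ^ k * b ^ (q - k)) = a ^ q + b ^ q"
    using q by simp
  also have "(\<Sum>k = 1..<q. of_nat (q choose k) * a ^ k * b ^ (q - k)) =
      (\<Sum>k = 1..<q. a * (of_nat p * (of_nat ((q choose k) div p) * a ^ (k - 1) * b ^ (q - k))))"
  proof (rule sum.cong[OF refl])
    fix k assume k: "k \<in> {1..<q}"
    then have "p dvd (q choose k)" using prime_dvd_choose_power[OF assms(1)] assms(2) by auto
    then have "q choose k = p * ((q choose k) div p)" by simp
    then have "(of_nat (q choose k) :: 'a) = of_nat p * of_nat ((q choose k) div p)"
      by (metis of_nat_mult)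
    moreover have "a ^ k = a * a ^ (k - 1)" using k by (cases k) auto
    ultimately show "of_nat (q choose k) * a ^ k * b ^ (q - k) =
        a * (of_nat p * (of_nat ((q choose k) div p) * a ^ (k - 1) * b ^ (q - k)))"
      by (simp only: mult_ac)
  qed
  finally show ?thesis by (simp only: sum_distrib_left)
qed

lemma ring_of_type_algebra_simps [simp]:
  "carrier (ring_of_type_algebra :: 'a::field ring) = UNIV"
  "x \<otimes>\<^bsub>ring_of_type_algebra\<^esub> y = (x * y :: 'a)"
  "x \<oplus>\<^bsub>ring_of_type_algebra\<^esub> y = (x + y :: 'a)"
  "\<one>\<^bsub>ring_of_type_algebra\<^esub> = (1 :: 'a)"
  "\<zero>\<^bsub>ring_of_type_algebra\<^esub> = (0 :: 'a)"
  by (auto simp: ring_of_type_algebra_def)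

lemma ring_of_type_algebra_inverses:
  "\<ominus>\<^bsub>ring_of_type_algebra\<^esub> x = (- x :: 'a::field)"
  "x \<noteq> 0 \<Longrightarrow> inv\<^bsub>ring_of_type_algebra\<^esub> x = (inverse x :: 'a::field)"
proof -
  interpret F: field "ring_of_type_algebra :: 'a ring" by (rule field_from_type_algebra)
  show "\<ominus>\<^bsub>ring_of_type_algebra\<^esub> x = - x" using F.minus_equality[of "- x" x] by simp
  show "x \<noteq> 0 \<Longrightarrow> inv\<^bsub>ring_of_type_algebra\<^esub> x = inverse x"
    using F.comm_inv_char[of x "inverse x"] by simp
qed

definition integral_poly :: "'a::field_char_0 poly \<Rightarrow> bool" where
  "integral_poly r \<longleftrightarrow> (\<forall>i. algebraic_int (Polynomial.coeff r i))"

lemma integral_poly_simps: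
  "integral_poly 0"
  "algebraic_int a \<Longrightarrow> integral_poly r \<Longrightarrow> integral_poly (pCons a r)"
  "integral_poly r \<Longrightarrow> integral_poly s \<Longrightarrow> integral_poly (r + s)"
  "integral_poly r \<Longrightarrow> integral_poly (- r)"
  "integral_poly r \<Longrightarrow> integral_poly s \<Longrightarrow> integral_poly (r - s)"
  "integral_poly r \<Longrightarrow> integral_poly s \<Longrightarrow> integral_poly (r * s)"
  "algebraic_int a \<Longrightarrow> integral_poly (Polynomial.monom a k)"
  unfolding integral_poly_def
  by (auto simp: coeff_pCons coeff_mult algebraic_int_add algebraic_int_diff
      intro!: algebraic_int_sum algebraic_int_mult split: nat.split)

locale radical_extension =
  fixes \<alpha> :: "'l::field_char_0" and \<phi> :: "'l \<Rightarrow> 'k::field_char_0" and \<beta> :: 'k and n :: nat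
  assumes nf: "number_field TYPE('l)"
    and n: "n \<ge> 2"
    and \<alpha>: "algebraic_int \<alpha>"
    and irred: "Factorial_Ring.irreducible (Polynomial.monom 1 n - [:\<alpha>:])"
    and hom: "\<phi> \<in> Ring.ring_hom ring_of_type_algebra ring_of_type_algebra"
    and \<beta>: "\<beta> ^ n = \<phi> \<alpha>"
begin

sublocale field_hom \<phi>
proof
  have add: "\<phi> (x + y) = \<phi> x + \<phi> y" and mult: "\<phi> (x * y) = \<phi> x * \<phi> y" and one: "\<phi> 1 = 1" for x y
    using hom unfolding Ring.ring_hom_def by auto
  then show "\<phi> (x + y) = \<phi> x + \<phi> y" "\<phi> (x * y) = \<phi> x * \<phi> y" "\<phi> 1 = 1" for x y by blast+
  show "\<phi> 0 = 0" using add[of 0 0] by simp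
qed

interpretation map_hom: map_poly_comm_ring_hom \<phi> ..

lemma hom_nat [simp]: "\<phi> (of_nat k) = of_nat k"
  by (induction k) (simp_all add: hom_add)

lemma hom_int [simp]: "\<phi> (of_int k) = of_int k"
  by (cases k rule: int_cases2) (simp_all add: hom_uminus)

lemma algebraic_int_hom:
  assumes "algebraic_int a"
  shows "algebraic_int (\<phi> a)"
proof -
  obtain d and c :: "nat \<Rightarrow> int" where "a ^ d = (\<Sum>i<d. of_int (c i) * a ^ i)"
    using algebraic_int_power_eq[OF assms] by blast
  then have "\<phi> (a ^ d) = \<phi> (\<Sum>i<d. of_int (c i) * a ^ i)" by simp
  then have "\<phi> a ^ d = (\<Sum>i<d. of_int (c i) * \<phi> a ^ i)"
    by (simp add: hom_sum hom_power hom_mult hom_int)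
  then show ?thesis by (rule algebraic_int_integral) simp
qed

section \<open>Elements of the order as polynomial values at the radical\<close>

definition ev :: "'l poly \<Rightarrow> 'k" where
  "ev s = poly (map_poly \<phi> s) \<beta>"

lemma ev_simps [simp]:
  "ev 0 = 0" "ev (pCons a s) = \<phi> a + \<beta> * ev s" "ev (s + r) = ev s + ev r" "ev (- s) = - ev s"
  "ev (s - r) = ev s - ev r" "ev (s * r) = ev s * ev r" "ev (Polynomial.monom a k) = \<phi> a * \<beta> ^ k"
  "ev (s ^ k) = ev s ^ k"
  unfolding ev_def
  by (simp_all add: Polynomial.map_poly_pCons map_hom.hom_add map_hom.hom_mult map_hom.hom_uminus
      map_hom.hom_minus map_hom.hom_power poly_monom)

definition R :: "'k set" where "R = adjoin_integers \<phi> \<beta>"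

lemma R_add: "x \<in> R \<Longrightarrow> y \<in> R \<Longrightarrow> x + y \<in> R"
  and R_mult: "x \<in> R \<Longrightarrow> y \<in> R \<Longrightarrow> x * y \<in> R"
  and R_uminus: "x \<in> R \<Longrightarrow> - x \<in> R"
  and R_one: "1 \<in> R"
  and R_hom: "algebraic_int a \<Longrightarrow> \<phi> a \<in> R"
  and R_root: "\<beta> \<in> R"
  using generate_ring.eng_add[of x ring_of_type_algebra _ y]
    generate_ring.eng_mult[of x ring_of_type_algebra _ y]
    generate_ring.a_inv[of x ring_of_type_algebra]
    generate_ring.one[of "ring_of_type_algebra :: 'k ring"]
    generate_ring.incl[of _ _ "ring_of_type_algebra :: 'k ring"]
  unfolding R_def adjoin_integers_def by (simp_all add: ring_of_type_algebra_inverses)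

lemma R_zero: "0 \<in> R" using R_hom[of 0] by simp

lemma R_diff: "x \<in> R \<Longrightarrow> y \<in> R \<Longrightarrow> x - y \<in> R"
  using R_add[OF _ R_uminus, of x y] by simp

lemma R_power: "x \<in> R \<Longrightarrow> x ^ k \<in> R"
  by (induction k) (auto intro: R_one R_mult)

lemma R_of_int: "of_int k \<in> R" using R_hom[of "of_int k"] by simp

lemma R_of_nat: "of_nat k \<in> R" using R_hom[of "of_nat k"] by simp

lemma R_sum: "(\<And>i. i \<in> A \<Longrightarrow> h i \<in> R) \<Longrightarrow> sum h A \<in> R"
  by (induction A rule: infinite_finite_induct) (auto intro: R_zero R_add)

text \<open>The cases of \<open>generate_ring\<close> for one and for negatives are absorbed into
  \<open>hom\<close> and \<open>mult\<close> through \<open>\<phi> 1\<close> and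
  \<open>\<phi> (-1)\<close>.\<close>

lemma R_induct [consumes 1, case_names hom root add mult]:
  assumes "x \<in> R" and hom: "\<And>a. algebraic_int a \<Longrightarrow> Q (\<phi> a)" and root: "Q \<beta>"
    and add: "\<And>x y. x \<in> R \<Longrightarrow> y \<in> R \<Longrightarrow> Q x \<Longrightarrow> Q y \<Longrightarrow> Q (x + y)"
    and mult: "\<And>x y. x \<in> R \<Longrightarrow> y \<in> R \<Longrightarrow> Q x \<Longrightarrow> Q y \<Longrightarrow> Q (x * y)"
  shows "Q x"
proof -
  have "x \<in> generate_ring ring_of_type_algebra (insert \<beta> (\<phi> ` integers_of UNIV))"
    using assms(1) unfolding R_def adjoin_integers_def .
  then show ?thesis
  proof (induction rule: generate_ring.induct)
    case one
    then show ?case using hom[of 1] by simp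
  next
    case (incl h)
    then show ?case using hom root by auto
  next
    case (a_inv h)
    have "h \<in> R" using a_inv(1) unfolding R_def adjoin_integers_def .
    then have "Q (\<phi> (-1) * h)" using a_inv R_hom[of "-1"] hom[of "-1"] by (intro mult) auto
    then show ?case by (simp add: ring_of_type_algebra_inverses hom_uminus)
  next
    case (eng_add h1 h2)
    then have "h1 \<in> R" "h2 \<in> R" unfolding R_def adjoin_integers_def by blast+
    then show ?case using add eng_add by simp
  next
    case (eng_mult h1 h2)
    then have "h1 \<in> R" "h2 \<in> R" unfolding R_def adjoin_integers_def by blast+
    then show ?case using mult eng_mult by simp
  qed
qed

lemma algebraic_int_root_beta: "algebraic_int \<beta>"
proof (rule algebraic_int_integral[of \<beta> n "\<lambda>i. if i = 0 then \<phi> \<alpha> else 0"])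
  show "\<beta> ^ n = (\<Sum>i<n. (if i = 0 then \<phi> \<alpha> else 0) * \<beta> ^ i)"
    using n \<beta> by (simp add: if_distrib[of "\<lambda>x. x * _"] cong: if_cong)
qed (use algebraic_int_hom[OF \<alpha>] in auto)

lemma R_algebraic_int: "x \<in> R \<Longrightarrow> algebraic_int x"
  by (induction rule: R_induct)
    (auto simp: algebraic_int_hom algebraic_int_root_beta algebraic_int_add algebraic_int_mult)

lemma ev_reduce:
  assumes "integral_poly r"
  shows "\<exists>s. integral_poly s \<and> Polynomial.degree s < n \<and> ev s = ev r"
  using assms
proof (induction r)
  case 0
  then show ?case using n by (intro exI[of _ 0]) (simp add: integral_poly_simps)
next
  case (pCons a r)
  have a: "algebraic_int a" and "integral_poly r"
    using pCons.prems unfolding integral_poly_def by (metis coeff_pCons_0, metis coeff_pCons_Suc)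
  then obtain s where s: "integral_poly s" "Polynomial.degree s < n" "ev s = ev r" using pCons.IH by blast
  define c where "c = Polynomial.coeff s (n - 1)"
  \<comment> \<open>Horner step: after multiplying \<open>s\<close> by the variable and adding
    \<open>a\<close>, the possible top term of degree \<open>n\<close> with coefficient
    \<open>c\<close> is replaced by the constant \<open>c * \<alpha>\<close>.\<close>
  define s' where "s' = pCons a s - Polynomial.monom c n + Polynomial.monom (c * \<alpha>) 0"
  have c: "algebraic_int c" using s(1) by (simp add: c_def integral_poly_def)
  have "integral_poly s'"
    unfolding s'_def using a s(1) c \<alpha> by (intro integral_poly_simps algebraic_int_mult)
  moreover have "Polynomial.coeff s' i = 0" if i: "i \<ge> n" for i
  proof (cases "i = n")
    case True
    then show ?thesis using n by (simp add: s'_def c_def coeff_pCons split: nat.split)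
  next
    case False
    then have "Polynomial.coeff s (i - 1) = 0" using i s(2) by (intro coeff_eq_0) auto
    then show ?thesis using False i n by (cases i) (simp_all add: s'_def coeff_pCons)
  qed
  then have "Polynomial.degree s' \<le> n - 1" by (intro degree_le) auto
  then have "Polynomial.degree s' < n" using n by simp
  moreover have "ev s' = ev (pCons a r)"
    using s(3) \<beta> by (simp add: s'_def hom_mult)
  ultimately show ?case by blast
qed

lemma R_representation:
  assumes "x \<in> R"
  shows "\<exists>s. integral_poly s \<and> Polynomial.degree s < n \<and> ev s = x"
proof -
  have "\<exists>s. integral_poly s \<and> ev s = x"
    using assms
  proof (induction rule: R_induct)
    case (hom a)
    then show ?case by (intro exI[of _ "[:a:]"]) (simp add: integral_poly_simps)
  next
    case root
    show ?case by (intro exI[of _ "Polynomial.monom 1 1"]) (simp add: integral_poly_simps)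
  next
    case (add x y)
    then show ?case by (metis ev_simps(3) integral_poly_simps(3))
  next
    case (mult x y)
    then show ?case by (metis ev_simps(6) integral_poly_simps(6))
  qed
  then show ?thesis using ev_reduce by metis
qed

text \<open>A nonzero polynomial \<open>g\<close> of least degree vanishing at
  \<open>\<beta>\<close> divides the irreducible \<open>x ^ n - \<alpha>\<close>. It is not a unit,
  so its degree is \<open>n\<close>.\<close>

lemma ev_eq_0:
  assumes "ev s = 0" "Polynomial.degree s < n"
  shows "s = 0"
proof (rule ccontr)
  assume "s \<noteq> 0"
  define f where "f = Polynomial.monom 1 n - [:\<alpha>:]"
  have evf: "ev f = 0" using \<beta> by (simp add: f_def)
  obtain g where g: "g \<noteq> 0" "ev g = 0" and min: "\<And>h. h \<noteq> 0 \<Longrightarrow> ev h = 0 \<Longrightarrow> Polynomial.degree g \<le> Polynomial.degree h"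
    using ex_has_least_nat[of "\<lambda>g. g \<noteq> 0 \<and> ev g = 0" s Polynomial.degree] \<open>s \<noteq> 0\<close> assms(1) by blast
  have dvd: "g dvd h" if "ev h = 0" for h
  proof -
    have "ev (h mod g) = 0"
      using that g(2) by (simp add: minus_div_mult_eq_mod[symmetric])
    then have "h mod g = 0"
      using min[of "h mod g"] degree_mod_less'[OF g(1), of h] by (meson not_le)
    then show ?thesis by auto
  qed
  have "Polynomial.degree f = n"
  proof (rule antisym)
    show "Polynomial.degree f \<le> n" unfolding f_def by (intro degree_diff_le) (auto simp: degree_monom_le)
    show "n \<le> Polynomial.degree f" unfolding f_def using n by (intro le_degree) (simp add: coeff_pCons split: nat.split)
  qed
  obtain h where h: "f = g * h" using dvd[OF evf] by blast
  then have "g dvd 1 \<or> h dvd 1" using irred unfolding f_def[symmetric] h using Factorial_Ring.irreducibleD by blast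
  then show False
  proof
    assume "g dvd 1"
    then obtain k where "1 = g * k" by blast
    then have "ev 1 = 0" using g(2) by (metis ev_simps(6) mult_zero_left)
    then show False by (simp add: one_pCons)
  next
    assume "h dvd 1"
    then have "h \<noteq> 0" "Polynomial.degree h = 0" by (auto simp: poly_dvd_1)
    then have "Polynomial.degree f = Polynomial.degree g" unfolding h using g(1) by (simp add: degree_mult_eq)
    moreover have "Polynomial.degree g \<le> Polynomial.degree s" using min \<open>s \<noteq> 0\<close> assms(1) by blast
    ultimately show False using \<open>Polynomial.degree f = n\<close> assms(2) by simp
  qed
qed

text \<open>Representations of degree below \<open>n\<close> are unique, so an integral one for this
  element would have \<open>a\<close> as its coefficient at the degree of \<open>g\<close>.\<close>

lemma scaled_monic_not_mem_R:
  assumes "\<not> algebraic_int a" "Polynomial.lead_coeff g = 1" "Polynomial.degree g < n"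
  shows "\<phi> a * ev g \<notin> R"
proof
  assume "\<phi> a * ev g \<in> R"
  then obtain s where s: "integral_poly s" "Polynomial.degree s < n" "ev s = \<phi> a * ev g"
    using R_representation by blast
  define h where "h = Polynomial.monom a 0 * g - s"
  have "ev h = 0" by (simp add: h_def s(3))
  moreover have "Polynomial.degree h < n"
    unfolding h_def using s(2) assms(3) by (intro degree_diff_less) (simp_all add: monom_0)
  ultimately have "h = 0" by (rule ev_eq_0)
  then have "s = Polynomial.smult a g" by (simp add: h_def monom_0)
  then have "Polynomial.coeff s (Polynomial.degree g) = a" using assms(2) by simp
  then show False using assms(1) s(1) unfolding integral_poly_def by metis
qed

lemma adjoin_field_denominator:
  assumes "y \<in> adjoin_field \<phi> \<beta>"
  shows "\<exists>a. algebraic_int a \<and> a \<noteq> 0 \<and> \<phi> a * y \<in> R"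
  using assms unfolding adjoin_field_def
proof (induction rule: generate_field.induct)
  case one
  then show ?case using R_one by (intro exI[of _ 1]) simp
next
  case (incl h)
  show ?case
  proof (cases "h = \<beta>")
    case True
    then show ?thesis using R_root by (intro exI[of _ 1]) simp
  next
    case False
    then obtain x where x: "h = \<phi> x" using incl by blast
    obtain c :: int where "c \<noteq> 0" "algebraic_int (of_int c * x)"
      using number_field_denominator[OF nf] by blast
    then show ?thesis
      using R_hom[of "of_int c * x"] by (intro exI[of _ "of_int c"]) (simp add: x hom_mult)
  qed
next
  case (a_inv h)
  then obtain a where a: "algebraic_int a" "a \<noteq> 0" "\<phi> a * h \<in> R" by blast
  then have "\<phi> a * \<ominus>\<^bsub>ring_of_type_algebra\<^esub> h \<in> R"
    using R_uminus[OF a(3)] by (simp add: ring_of_type_algebra_inverses)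
  then show ?case using a by blast
next
  case (m_inv h)
  then obtain a where a: "algebraic_int a" "a \<noteq> 0" "\<phi> a * h \<in> R" by blast
  define w where "w = \<phi> a * h"
  have w: "w \<in> R" "w \<noteq> 0" using a m_inv(2) by (auto simp: w_def)
  \<comment> \<open>The inverse of \<open>w\<close> is \<open>1 / N\<close> times a polynomial in
    \<open>w\<close>, and that polynomial value lies in \<open>R\<close>; thus \<open>N\<close> is a
    denominator for the inverse of \<open>h\<close>.\<close>
  obtain r :: "int poly" and N where N: "N > 0" "w * poly (map_poly of_int r) w = of_nat N"
    using algebraic_int_dvd_of_nat[OF R_algebraic_int[OF w(1)] w(2)] by blast
  have pw: "poly (map_poly of_int q) w \<in> R" for q :: "int poly"
    by (induction q) (auto simp: map_poly_pCons intro!: R_zero R_add R_mult R_of_int w(1))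
  have h0: "h \<noteq> 0" using m_inv(2) by simp
  have "h * (\<phi> a * poly (map_poly of_int r) w) = \<phi> (of_nat N)"
    using N(2) by (simp add: w_def mult_ac)
  then have "\<phi> (of_nat N) * inverse h = \<phi> a * poly (map_poly of_int r) w"
    using h0 by (simp add: field_simps)
  also have "\<dots> \<in> R" using R_mult[OF R_hom[OF a(1)] pw] .
  finally show ?case
    using N(1) h0 by (intro exI[of _ "of_nat N"]) (simp add: ring_of_type_algebra_inverses)
next
  case (eng_add h1 h2)
  then obtain a b where a: "algebraic_int a" "a \<noteq> 0" "\<phi> a * h1 \<in> R"
    and b: "algebraic_int b" "b \<noteq> 0" "\<phi> b * h2 \<in> R" by blast
  have "\<phi> b * (\<phi> a * h1) + \<phi> a * (\<phi> b * h2) \<in> R"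
    by (intro R_add R_mult[OF R_hom] a b)
  then have "\<phi> (a * b) * (h1 + h2) \<in> R" by (simp add: hom_mult algebra_simps)
  then show ?case using a b algebraic_int_mult by (intro exI[of _ "a * b"]) auto
next
  case (eng_mult h1 h2)
  then obtain a b where a: "algebraic_int a" "a \<noteq> 0" "\<phi> a * h1 \<in> R"
    and b: "algebraic_int b" "b \<noteq> 0" "\<phi> b * h2 \<in> R" by blast
  have "(\<phi> a * h1) * (\<phi> b * h2) \<in> R" by (rule R_mult[OF a(3) b(3)])
  then have "\<phi> (a * b) * (h1 * h2) \<in> R" by (simp add: hom_mult mult_ac)
  then show ?case using a b algebraic_int_mult by (intro exI[of _ "a * b"]) auto
qed

lemma R_subset_adjoin_field: "R \<subseteq> adjoin_field \<phi> \<beta>"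
proof
  fix x assume "x \<in> R"
  then have "x \<in> generate_ring ring_of_type_algebra (insert \<beta> (\<phi> ` integers_of UNIV))"
    unfolding R_def adjoin_integers_def .
  then show "x \<in> adjoin_field \<phi> \<beta>"
    unfolding adjoin_field_def
  proof (induction rule: generate_ring.induct)
    case (incl h)
    then show ?case by (intro generate_field.incl) auto
  qed (auto intro: generate_field.intros simp del: ring_of_type_algebra_simps)
qed

end

section \<open>Maximality at a prime\<close>

text \<open>The Frobenius of the residue field is iterated. Multiples of
  \<open>residue_degree P\<close> matter because the exponent \<open>f - \<epsilon> + e\<close> of
  the criterion is one.\<close>

lemma (in inverted_prime) fermat:
  assumes "algebraic_int a" "residue_degree P dvd s"
  shows "a ^ (residue_char P ^ s) - a \<in> P"
proof (cases "a \<in> P")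
  case True
  have "residue_char P ^ s > 0" using prime_gt_0_nat[OF prime_residue_char] by simp
  then have "a ^ (residue_char P ^ s) = a * a ^ (residue_char P ^ s - 1)"
    by (metis power_eq_if not_gr_zero)
  then have "a ^ (residue_char P ^ s) \<in> P"
    using idP(5)[OF True algebraic_int_power[OF assms(1)]] by metis
  then show ?thesis using True idP(7) by blast
next
  case False
  define Q where "Q = residue_char P ^ residue_degree P"
  obtain k where k: "s = residue_degree P * k" using assms(2) by blast
  have "Q > 0" unfolding Q_def using prime_gt_0_nat[OF prime_residue_char] by simp
  have "a ^ (Q ^ k) - a \<in> P"
  proof (induction k)
    case 0
    then show ?case using idP(2) by simp
  next
    case (Suc k)
    let ?b = "a ^ (Q ^ k)"
    have b: "algebraic_int ?b" by (rule algebraic_int_power[OF assms(1)])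
    have "?b \<notin> P" using False prime_power_mem[OF P(1) assms(1)] by blast
    then have "?b * (?b ^ (Q - 1) - 1) \<in> P"
      using idP(4)[OF fermat_nonzero[OF b] b] unfolding Q_def by blast
    also have "?b * (?b ^ (Q - 1) - 1) = ?b ^ Q - ?b"
      using \<open>Q > 0\<close> by (cases Q) (simp_all add: algebra_simps)
    finally have "(?b ^ Q - ?b) + (?b - a) \<in> P" using idP(3) Suc by blast
    then show ?case by (simp add: power_mult[symmetric] mult.commute)
  qed
  then show ?thesis by (simp add: k Q_def power_mult)
qed

locale radical_at_prime = radical_extension \<alpha> \<phi> \<beta> n + inverted_prime P \<gamma> t
  for \<alpha> :: "'l::field_char_0" and \<phi> :: "'l \<Rightarrow> 'k::field_char_0" and \<beta> n
    and P :: "'l set" and \<gamma> t :: 'l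
begin

text \<open>This is the extended ideal, because \<open>x = t(\<gamma>x) - (\<gamma>t - 1)x\<close>.\<close>

definition PR :: "'k set" where "PR = {x \<in> R. \<phi> \<gamma> * x \<in> R}"

lemma PR_add: "x \<in> PR \<Longrightarrow> y \<in> PR \<Longrightarrow> x + y \<in> PR"
  by (simp add: PR_def R_add distrib_left)

lemma PR_mult: "x \<in> PR \<Longrightarrow> y \<in> R \<Longrightarrow> y * x \<in> PR"
  by (simp add: PR_def R_mult mult.left_commute[of "\<phi> \<gamma>"])

lemma PR_uminus: "x \<in> PR \<Longrightarrow> - x \<in> PR"
  using PR_mult[OF _ R_uminus[OF R_one], of x] by simp

lemma PR_diff: "x \<in> PR \<Longrightarrow> y \<in> PR \<Longrightarrow> x - y \<in> PR"
  using PR_add[OF _ PR_uminus, of x y] by simp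

lemma PR_hom: "a \<in> P \<Longrightarrow> \<phi> a \<in> PR"
  using R_hom[OF idP(1)] R_hom[OF inverse_mult] by (simp add: PR_def hom_mult)

lemma PR_zero: "0 \<in> PR" by (simp add: PR_def R_zero)

lemma PR_sum: "(\<And>i. i \<in> A \<Longrightarrow> h i \<in> PR) \<Longrightarrow> sum h A \<in> PR"
  by (induction A rule: infinite_finite_induct) (auto intro: PR_zero PR_add)

text \<open>With \<open>b'\<close> inverse to \<open>b\<close> modulo \<open>P\<close>,
  \<open>x = b' (b x) - (b b' - 1) x\<close>.\<close>

lemma PR_cancel:
  assumes "x \<in> R" "algebraic_int b" "b \<notin> P" "\<phi> b * x \<in> PR"
  shows "x \<in> PR"
proof -
  obtain b' where b': "algebraic_int b'" "b * b' - 1 \<in> P"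
    using inverse_mod_prime[OF nf prime assms(2,3)] by blast
  have "\<phi> b' * (\<phi> b * x) - x * \<phi> (b * b' - 1) \<in> PR"
    by (intro PR_diff PR_mult[OF assms(4) R_hom[OF b'(1)]] PR_mult[OF PR_hom[OF b'(2)] assms(1)])
  then show ?thesis by (simp add: hom_mult hom_minus algebra_simps)
qed

text \<open>A monic equation of degree \<open>N\<close> for \<open>y = \<gamma> g\<close> is
  multiplied by \<open>t ^ N\<close>. Each lower term then has a factor \<open>t\<close>, so
  \<open>(\<tau> g) ^ N\<close> lies in \<open>PR\<close> for \<open>\<tau> = \<gamma> t\<close>,
  and the unit \<open>\<tau>\<close> modulo \<open>P\<close> can be cancelled.\<close>

lemma nilpotent_mod_PR:
  assumes g: "g \<in> R" "algebraic_int (\<phi> \<gamma> * g)"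
  shows "\<exists>N. g ^ N \<in> PR"
proof -
  define y where "y = \<phi> \<gamma> * g"
  obtain N and c :: "nat \<Rightarrow> int" where y: "y ^ N = (\<Sum>i<N. of_int (c i) * y ^ i)"
    using algebraic_int_power_eq[OF g(2)[folded y_def]] by blast
  define \<tau> where "\<tau> = \<gamma> * t"
  have \<tau>: "algebraic_int \<tau>" unfolding \<tau>_def by (rule inverse_mult[OF t_mem])
  have "\<tau> \<notin> P" using idP(7)[OF _ inverse_mult_t, of \<tau>] P(4) by (auto simp: \<tau>_def)
  then have \<tau>N: "\<tau> ^ N \<notin> P" using prime_power_mem[OF P(1) \<tau>] by blast
  have ty: "\<phi> t * y = \<phi> \<tau> * g" by (simp add: y_def \<tau>_def hom_mult mult_ac)
  have "\<phi> (\<tau> ^ N) * g ^ N = \<phi> t ^ N * y ^ N"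
    unfolding hom_power power_mult_distrib[symmetric] ty ..
  also have "\<dots> = (\<Sum>i<N. \<phi> t ^ N * (of_int (c i) * y ^ i))"
    unfolding y by (rule sum_distrib_left)
  also have "\<dots> \<in> PR"
  proof (rule PR_sum)
    fix i assume "i \<in> {..<N}"
    then have "N = Suc (N - Suc i) + i" by simp
    then have "\<phi> t ^ N = \<phi> t * \<phi> t ^ (N - Suc i) * \<phi> t ^ i" by (metis power_add power_Suc)
    then have "\<phi> t ^ N * (of_int (c i) * y ^ i) = (\<phi> t ^ (N - Suc i) * (of_int (c i) * (\<phi> t * y) ^ i)) * \<phi> t"
      by (simp add: power_mult_distrib mult_ac)
    also have "\<dots> \<in> PR"
      unfolding ty
      by (intro PR_mult PR_hom t_mem R_mult R_power R_hom[OF idP(1)[OF t_mem]] R_of_int R_hom[OF \<tau>] g(1))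
    finally show "\<phi> t ^ N * (of_int (c i) * y ^ i) \<in> PR" .
  qed
  finally show ?thesis
    using PR_cancel[OF R_power[OF g(1)] algebraic_int_power[OF \<tau>] \<tau>N] by blast
qed

section \<open>The quotient by \<open>\<eta>\<close> and \<open>P\<close>, its Frobenius map, and
  local maximality\<close>

definition J :: "'k \<Rightarrow> 'k set" where "J \<eta> = {\<eta> * a + b | a b. a \<in> R \<and> b \<in> PR}"

lemma J_add: assumes "x \<in> J \<eta>" "y \<in> J \<eta>" shows "x + y \<in> J \<eta>"
proof -
  obtain a b a' b' where "x = \<eta> * a + b" "y = \<eta> * a' + b'" and *: "a \<in> R" "a' \<in> R" "b \<in> PR" "b' \<in> PR"
    using assms unfolding J_def by blast
  then have "x + y = \<eta> * (a + a') + (b + b')" by (simp add: algebra_simps)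
  then show ?thesis unfolding J_def using R_add[OF *(1,2)] PR_add[OF *(3,4)] by blast
qed

lemma J_mult: assumes "x \<in> J \<eta>" "y \<in> R" shows "y * x \<in> J \<eta>"
proof -
  obtain a b where "x = \<eta> * a + b" and *: "a \<in> R" "b \<in> PR" using assms unfolding J_def by blast
  then have "y * x = \<eta> * (y * a) + y * b" by (simp add: algebra_simps)
  then show ?thesis unfolding J_def using R_mult[OF assms(2) *(1)] PR_mult[OF *(2) assms(2)] by blast
qed

lemma J_diff: assumes "x \<in> J \<eta>" "y \<in> J \<eta>" shows "x - y \<in> J \<eta>"
  using J_add[OF assms(1) J_mult[OF assms(2) R_uminus[OF R_one]]] by simp

lemma PR_J: assumes "x \<in> PR" shows "x \<in> J \<eta>"
proof -
  have "x = \<eta> * 0 + x" by simp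
  then show ?thesis unfolding J_def using R_zero assms by blast
qed

lemma eta_J: "\<eta> \<in> J \<eta>"
proof -
  have "\<eta> = \<eta> * 1 + 0" by simp
  then show ?thesis unfolding J_def using R_one PR_zero by blast
qed

lemma J_power_diff: assumes "x \<in> R" "y \<in> R" "x - y \<in> J \<eta>" shows "x ^ k - y ^ k \<in> J \<eta>"
proof -
  have "(\<Sum>i<k. y ^ (k - Suc i) * x ^ i) * (x - y) \<in> J \<eta>"
    using assms by (intro J_mult R_sum R_mult R_power)
  then show ?thesis by (simp add: power_diff_sumr2 mult.commute)
qed

text \<open>Iterating \<open>frob\<close> gives \<open>u ^ (r ^ N)\<close> congruent to
  \<open>u\<close>, and \<open>r ^ N\<close> is at least \<open>N\<close>, so the former lies in
  \<open>J \<eta>\<close>.\<close>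

lemma reduced_mod_J:
  assumes frob: "\<And>u. u \<in> R \<Longrightarrow> u ^ r - u \<in> J \<eta>" and r: "r \<ge> 2"
    and u: "u \<in> R" "u ^ N \<in> J \<eta>"
  shows "u \<in> J \<eta>"
proof -
  have iter: "u ^ (r ^ k) - u \<in> J \<eta>" for k
  proof (induction k)
    case 0
    then show ?case using PR_J[OF PR_zero] by simp
  next
    case (Suc k)
    have "((u ^ (r ^ k)) ^ r - u ^ (r ^ k)) + (u ^ (r ^ k) - u) \<in> J \<eta>"
      by (intro J_add frob R_power u Suc)
    then show ?case by (simp add: power_mult[symmetric] mult.commute)
  qed
  have "N \<le> r ^ N" using power_gt_expt[of r N] r by simp
  then have "u ^ (r ^ N) = u ^ (r ^ N - N) * u ^ N" by (simp add: power_add[symmetric])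
  then have "u ^ (r ^ N) \<in> J \<eta>" using J_mult[OF u(2) R_power[OF u(1)]] by simp
  from J_diff[OF this iter[of N]] show ?thesis by simp
qed

text \<open>
  Write \<open>x \<in> R\<close> with \<open>\<gamma>x\<close> integral as \<open>\<eta>\<^sup>j u\<close> modulo \<open>PR\<close> with \<open>j < q\<close> maximal. Then \<open>y = \<gamma>\<eta>\<^bsup>q-1\<^esup>u\<close> is
  integral, and \<open>\<gamma>cu = - \<eta>(y + \<gamma>Gu)\<close> where \<open>\<gamma>c\<close> is a unit modulo \<open>P\<close>. So a power of \<open>u\<close> lies in \<open>PR\<close>,
  and \<open>u \<in> \<eta>R + PR\<close> because \<open>R / (\<eta>R + PR)\<close> is reduced, against the maximality of \<open>j\<close>.
\<close>

lemma maximal_at_prime: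
  assumes frob: "\<And>u. u \<in> R \<Longrightarrow> u ^ r - u \<in> J \<eta>" and r: "r \<ge> 2"
    and \<eta>: "\<eta> \<in> R" "\<eta> ^ q = - (\<eta> * G) - \<phi> c" and G: "G \<in> PR"
    and c: "c \<in> P" "c \<notin> ideal_square P"
    and x: "x \<in> R" "algebraic_int (\<phi> \<gamma> * x)"
  shows "x \<in> PR"
proof (rule ccontr)
  assume "x \<notin> PR"
  \<comment> \<open>This filtration descends from \<open>A 0 = R\<close> to \<open>A q = PR\<close>,
    the latter because \<open>\<eta> ^ q\<close> is in \<open>PR\<close>; \<open>x\<close> must drop
    out at some step.\<close>
  define A where "A j = {\<eta> ^ j * a + b | a b. a \<in> R \<and> b \<in> PR}" for j
  have \<eta>q: "\<eta> ^ q \<in> PR"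
    unfolding \<eta>(2) by (intro PR_diff PR_uminus PR_mult[OF G \<eta>(1)] PR_hom[OF c(1)])
  have "x = \<eta> ^ 0 * x + 0" by simp
  then have "x \<in> A 0" unfolding A_def using x(1) PR_zero by blast
  moreover have "x \<notin> A q"
  proof
    assume "x \<in> A q"
    then obtain a b where "x = \<eta> ^ q * a + b" "a \<in> R" "b \<in> PR" unfolding A_def by blast
    then have "x \<in> PR" using PR_add[OF PR_mult[OF \<eta>q, of a], of b] by (simp add: mult.commute)
    then show False using \<open>x \<notin> PR\<close> by blast
  qed
  ultimately have "\<exists>j<q. x \<in> A j \<and> x \<notin> A (Suc j)"
    using dec_induct[of 0 q "\<lambda>j. x \<in> A j"] by blast
  then obtain j where j: "j < q" "x \<in> A j" "x \<notin> A (Suc j)" by blast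
  then obtain u b where u: "u \<in> R" and b: "b \<in> PR" and xj: "x = \<eta> ^ j * u + b"
    unfolding A_def by blast
  have "u \<notin> J \<eta>"
  proof
    assume "u \<in> J \<eta>"
    then obtain a b' where ab: "u = \<eta> * a + b'" "a \<in> R" "b' \<in> PR" unfolding J_def by blast
    have "x = \<eta> ^ Suc j * a + (\<eta> ^ j * b' + b)" by (simp add: xj ab(1) algebra_simps)
    then have "x \<in> A (Suc j)"
      unfolding A_def using ab(2) PR_add[OF PR_mult[OF ab(3) R_power[OF \<eta>(1)]] b] by blast
    then show False using j(3) by blast
  qed
  define l where "l = q - 1 - j"
  have q: "q = Suc (l + j)" using j(1) by (simp add: l_def)
  define y where "y = \<phi> \<gamma> * (\<eta> ^ (l + j) * u)"
  have "y = \<eta> ^ l * (\<phi> \<gamma> * x) - \<eta> ^ l * (\<phi> \<gamma> * b)"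
    by (simp add: y_def xj power_add algebra_simps)
  moreover have "\<phi> \<gamma> * b \<in> R" using b by (simp add: PR_def)
  ultimately have y: "algebraic_int y"
    using x(2) R_algebraic_int[OF R_power[OF \<eta>(1), of l]] R_algebraic_int[of "\<phi> \<gamma> * b"]
    by (simp add: algebraic_int_diff algebraic_int_mult)
  define z where "z = y + \<phi> \<gamma> * G * u"
  have "\<phi> \<gamma> * G \<in> R" using G by (simp add: PR_def)
  then have z: "algebraic_int z"
    unfolding z_def using R_algebraic_int[OF R_mult[OF _ u]] by (intro algebraic_int_add y) blast
  define d where "d = \<gamma> * c"
  have d: "algebraic_int d" unfolding d_def by (rule inverse_mult[OF c(1)])
  have dP: "d \<notin> P" unfolding d_def using c square_iff by blast
  have \<eta>y: "\<eta> * y = \<phi> \<gamma> * (\<eta> ^ q * u)" by (simp add: y_def q mult_ac)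
  have "\<eta> * z = - (\<phi> d * u)"
    unfolding z_def distrib_left \<eta>y \<eta>(2) d_def by (simp add: hom_mult algebra_simps)
  then have eq: "\<phi> d * u = - (\<eta> * z)" by simp
  \<comment> \<open>Raising \<open>\<phi> d * u = - \<eta> z\<close> to the power \<open>q\<close>
    produces the factor \<open>\<eta> ^ q\<close> in \<open>PR\<close>. It absorbs
    \<open>\<gamma>\<close>, so \<open>\<gamma> v\<close> is integral and \<open>v\<close> is
    nilpotent modulo \<open>PR\<close>.\<close>
  define v where "v = (\<phi> d * u) ^ q"
  have vR: "v \<in> R" unfolding v_def by (intro R_power R_mult R_hom d u)
  have \<gamma>v: "\<phi> \<gamma> * v = (-1) ^ q * (\<phi> \<gamma> * \<eta> ^ q) * z ^ q"
    unfolding v_def eq by (simp add: power_mult_distrib power_minus[of "\<eta> * z"] mult_ac)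
  have "\<phi> \<gamma> * \<eta> ^ q \<in> R" using \<eta>q by (simp add: PR_def)
  then have "algebraic_int (\<phi> \<gamma> * v)"
    unfolding \<gamma>v using R_uminus[OF R_one]
    by (intro algebraic_int_mult[OF algebraic_int_mult] algebraic_int_power z R_algebraic_int)
  from nilpotent_mod_PR[OF vR this] obtain N where "v ^ N \<in> PR" by blast
  then have "\<phi> (d ^ (q * N)) * u ^ (q * N) \<in> PR"
    by (simp add: v_def power_mult_distrib power_mult[symmetric] hom_power)
  moreover have "d ^ (q * N) \<notin> P" using prime_power_mem[OF P(1) d] dP by blast
  ultimately have "u ^ (q * N) \<in> PR"
    using PR_cancel[OF R_power[OF u] algebraic_int_power[OF d]] by blast
  then have "u \<in> J \<eta>" using reduced_mod_J[OF frob r u] PR_J by blast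
  then show False using \<open>u \<notin> J \<eta>\<close> by blast
qed

text \<open>Here \<open>J 0\<close> is \<open>PR\<close> itself, so \<open>R / PR\<close> is reduced
  while \<open>x\<close> is nilpotent in it.\<close>

lemma maximal_at_prime_unramified:
  assumes frob: "\<And>u. u \<in> R \<Longrightarrow> u ^ r - u \<in> J 0" and r: "r \<ge> 2"
    and x: "x \<in> R" "algebraic_int (\<phi> \<gamma> * x)"
  shows "x \<in> PR"
proof -
  obtain N where "x ^ N \<in> PR" using nilpotent_mod_PR[OF x] by blast
  then have "x \<in> J 0" using reduced_mod_J[OF frob r x(1)] PR_J by blast
  then show ?thesis unfolding J_def by auto
qed

text \<open>Modulo \<open>J \<eta>\<close>, which contains \<open>p\<close>, the map
  \<open>u \<mapsto> u ^ (p ^ s)\<close> is a ring homomorphism. It suffices that it fixes the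
  generators: the base integers by \<open>fermat\<close>, and \<open>\<beta>\<close> by
  hypothesis.\<close>

lemma frobenius_mod_J:
  assumes "residue_degree P dvd s" and \<eta>: "\<eta> \<in> R" and root: "\<beta> ^ (residue_char P ^ s) - \<beta> \<in> J \<eta>"
    and "u \<in> R"
  shows "u ^ (residue_char P ^ s) - u \<in> J \<eta>"
  using \<open>u \<in> R\<close>
proof (induction rule: R_induct)
  case (hom a)
  then show ?case
    using PR_J[OF PR_hom[OF fermat[OF hom assms(1)]]] by (simp add: hom_minus hom_power)
next
  case root
  show ?case by (fact assms(3))
next
  case (add x y)
  let ?q = "residue_char P ^ s" and ?p = "residue_char P"
  define S where "S = (\<Sum>k = 1..<?q. of_nat ((?q choose k) div ?p) * x ^ (k - 1) * y ^ (?q - k))"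
  have "S \<in> R" unfolding S_def using add(1,2) by (intro R_sum R_mult R_power R_of_nat)
  have "\<phi> (of_nat ?p) \<in> PR" using residue_char_dvd_iff[of ?p] by (intro PR_hom) simp
  then have "(x * S) * of_nat ?p \<in> J \<eta>"
    using PR_J PR_mult R_mult[OF add(1) \<open>S \<in> R\<close>] by simp
  then have "((x ^ ?q - x) + (y ^ ?q - y)) + (x * S) * of_nat ?p \<in> J \<eta>"
    using add J_add by blast
  moreover have "(x + y) ^ ?q = x ^ ?q + y ^ ?q + x * (of_nat ?p * S)"
    unfolding S_def by (rule binomial_prime_power[OF prime_residue_char refl])
  ultimately show ?case by (simp add: algebra_simps)
next
  case (mult x y)
  let ?q = "residue_char P ^ s"
  have "x ^ ?q * (y ^ ?q - y) + y * (x ^ ?q - x) \<in> J \<eta>"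
    using mult by (intro J_add J_mult R_power)
  then show ?case by (simp add: power_mult_distrib algebra_simps)
qed

text \<open>Modulo \<open>\<eta>R + PR\<close>, where \<open>\<eta> = \<beta>\<^sup>m - a\<close>, \<open>\<beta>\<close> is a root of unity of order prime to \<open>p\<close>.\<close>

lemma frobenius_exists:
  assumes a: "algebraic_int a" "a \<notin> P" and m: "m > 0" "coprime m (residue_char P)"
  shows "\<exists>r\<ge>2. \<forall>u\<in>R. u ^ r - u \<in> J (\<beta> ^ m - \<phi> a)"
proof -
  define \<eta> where "\<eta> = \<beta> ^ m - \<phi> a"
  have \<eta>: "\<eta> \<in> R" unfolding \<eta>_def by (intro R_diff R_power R_root R_hom a)
  let ?p = "residue_char P" and ?f = "residue_degree P"
  define Q where "Q = ?p ^ ?f"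
  have p: "?p \<ge> 2" using prime_ge_2_nat[OF prime_residue_char] .
  have Q: "Q \<ge> 2" unfolding Q_def using p residue_degree_pos
    by (metis le_trans self_le_power numeral_le_one_iff le_numeral_extra(4) one_le_numeral semiring_norm(69))
  \<comment> \<open>Modulo \<open>J \<eta>\<close>, \<open>\<beta> ^ m\<close> is \<open>a\<close>
    and \<open>a ^ (Q - 1)\<close> is 1, so \<open>\<beta> ^ M\<close> is 1.\<close>
  define M where "M = m * (Q - 1)"
  have M: "M > 0" using m(1) Q by (simp add: M_def)
  have "coprime (Q - 1) Q" using Q coprime_diff_one_left_nat[of Q] by simp
  then have "coprime (Q - 1) ?p"
    unfolding Q_def using residue_degree_pos by (simp add: coprime_power_right_iff)
  then have "coprime Q M"
    unfolding Q_def M_def[unfolded Q_def] using m(2) by (simp add: coprime_commute)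
  then have "[Q ^ totient M = 1] (mod M)" by (rule euler_theorem)
  \<comment> \<open>By Euler's theorem this power of \<open>Q\<close> is 1 modulo \<open>M\<close>,
    so that \<open>\<beta> ^ r\<close> is congruent to \<open>\<beta>\<close>.\<close>
  moreover define r where "r = Q ^ totient M"
  ultimately have "[r = 1] (mod M)" by simp
  have tot: "totient M > 0" using M by simp
  have r: "r \<ge> 2" unfolding r_def using Q tot
    by (metis le_trans self_le_power one_le_numeral)
  obtain k where k: "r = 1 + M * k"
    using \<open>[r = 1] (mod M)\<close> r cong_to_1_nat[of r M] by (metis dvd_def le_add_diff_inverse one_le_numeral order_trans)
  have J1: "\<beta> ^ M - 1 \<in> J \<eta>"
  proof -
    have "(\<beta> ^ m) ^ (Q - 1) - (\<phi> a) ^ (Q - 1) \<in> J \<eta>"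
      using eta_J[of \<eta>] by (intro J_power_diff R_power R_root R_hom a) (simp add: \<eta>_def)
    moreover have "\<phi> (a ^ (Q - 1) - 1) \<in> J \<eta>"
      using fermat_nonzero[OF a] unfolding Q_def by (intro PR_J PR_hom)
    ultimately have "((\<beta> ^ m) ^ (Q - 1) - (\<phi> a) ^ (Q - 1)) + \<phi> (a ^ (Q - 1) - 1) \<in> J \<eta>" by (rule J_add)
    then show ?thesis by (simp add: hom_minus hom_power M_def power_mult)
  qed
  have "\<beta> * ((\<beta> ^ M) ^ k - 1 ^ k) \<in> J \<eta>"
    by (intro J_mult J_power_diff J1 R_power R_root R_one)
  then have "\<beta> ^ r - \<beta> \<in> J \<eta>" by (simp add: k power_add power_mult algebra_simps)
  moreover have "r = ?p ^ (?f * totient M)" by (simp add: r_def Q_def power_mult)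
  ultimately have "u ^ r - u \<in> J \<eta>" if "u \<in> R" for u
    using frobenius_mod_J[of "?f * totient M" \<eta> u] \<eta> that by simp
  then show ?thesis using r unfolding \<eta>_def by blast
qed

text \<open>Since \<open>\<beta>\<close> vanishes modulo \<open>J \<beta>\<close>, the order of the
  residue field is already a suitable exponent.\<close>

lemma frobenius_exists_root:
  "\<exists>r\<ge>2. \<forall>u\<in>R. u ^ r - u \<in> J \<beta>"
proof -
  let ?q = "residue_char P ^ residue_degree P"
  have q: "?q \<ge> 2" using prime_ge_2_nat[OF prime_residue_char] residue_degree_pos
    by (metis le_trans self_le_power one_le_numeral)
  then have "\<beta> ^ ?q - \<beta> = (\<beta> ^ (?q - 1) - 1) * \<beta>"
    by (cases ?q) (simp_all add: algebra_simps)
  then have "\<beta> ^ ?q - \<beta> \<in> J \<beta>"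
    using J_mult[OF eta_J R_diff[OF R_power[OF R_root] R_one]] by metis
  then have "\<forall>u\<in>R. u ^ ?q - u \<in> J \<beta>" using frobenius_mod_J[OF dvd_refl R_root] by blast
  then show ?thesis using q by blast
qed

lemma not_maximal_at_prime:
  assumes \<eta>: "\<eta> \<in> R" "\<eta> ^ q = - (\<eta> * G) - \<phi> c" and q: "q \<ge> 2" and G: "G \<in> PR" and c: "c \<in> ideal_square P"
    and g: "\<eta> ^ (q - 1) = ev g" "Polynomial.lead_coeff g = 1" "Polynomial.degree g < n"
  shows "\<phi> \<gamma> * \<eta> ^ (q - 1) \<in> integers_of (adjoin_field \<phi> \<beta>)" "\<phi> \<gamma> * \<eta> ^ (q - 1) \<notin> R"
proof -
  define w where "w = \<phi> \<gamma> * \<eta> ^ (q - 1)"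
  define l where "l = q - 2"
  have l: "q = Suc (Suc l)" using q by (simp add: l_def)
  define A where "A = \<phi> \<gamma> * G"
  define b where "b = \<gamma> * (\<gamma> * c)"
  have A: "A \<in> R" using G by (simp add: A_def PR_def)
  \<comment> \<open>Because \<open>c\<close> lies in the square of \<open>P\<close>,
    \<open>\<gamma> * c\<close> is still in \<open>P\<close> and can absorb a second
    \<open>\<gamma>\<close>.\<close>
  have b: "algebraic_int b" unfolding b_def using c square_iff inverse_mult by blast
  \<comment> \<open>The exponent \<open>2 * (q - 1)\<close> is split as \<open>(q - 2) + q\<close>,
    which uses \<open>q \<ge> 2\<close>, and the relation is applied to
    \<open>\<eta> ^ q\<close>.\<close>
  have "w\<^sup>2 = \<phi> \<gamma> * \<phi> \<gamma> * \<eta> ^ l * \<eta> ^ q"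
    by (simp add: w_def l power2_eq_square mult_ac)
  also have "\<dots> = (- A) * w + - (\<phi> b * \<eta> ^ l)"
    unfolding \<eta>(2) by (simp add: w_def A_def b_def l hom_mult algebra_simps)
  finally have "w\<^sup>2 = (- A) * w + - (\<phi> b * \<eta> ^ l)" .
  then have "algebraic_int w"
    by (rule algebraic_int_quadratic) (intro R_algebraic_int R_uminus R_mult R_power A \<eta>(1) R_hom b)+
  moreover have "\<phi> \<gamma> \<in> adjoin_field \<phi> \<beta>"
    unfolding adjoin_field_def by (intro generate_field.incl) simp
  then have "\<phi> \<gamma> \<otimes>\<^bsub>ring_of_type_algebra\<^esub> \<eta> ^ (q - 1) \<in> adjoin_field \<phi> \<beta>"
    using R_subset_adjoin_field R_power[OF \<eta>(1)] unfolding adjoin_field_def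
    by (intro generate_field.eng_mult) auto
  ultimately show "\<phi> \<gamma> * \<eta> ^ (q - 1) \<in> integers_of (adjoin_field \<phi> \<beta>)"
    by (simp add: integers_of_def w_def)
  show "\<phi> \<gamma> * \<eta> ^ (q - 1) \<notin> R"
    unfolding g(1) by (rule scaled_monic_not_mem_R[OF inverse_not_integral g(2,3)])
qed

end

section \<open>The local criterion in terms of \<alpha>\<close>

context radical_at_prime
begin

text \<open>The expansion of \<open>\<alpha> = (\<eta> + a) ^ q\<close>; here \<open>G\<close> is
  \<open>p\<close> times the cofactor in the binomial error term.\<close>

lemma root_power_relation:
  assumes "\<eta> = \<beta> ^ m - \<phi> a" "n = q * m" "q = residue_char P ^ e" "algebraic_int a"
  shows "\<exists>G\<in>PR. \<eta> ^ q = - (\<eta> * G) - \<phi> (a ^ q - \<alpha>)"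
proof -
  let ?p = "residue_char P"
  define S where "S = (\<Sum>k = 1..<q. of_nat ((q choose k) div ?p) * \<eta> ^ (k - 1) * \<phi> a ^ (q - k))"
  have \<eta>: "\<eta> \<in> R" unfolding assms(1) by (intro R_diff R_power R_root R_hom assms(4))
  have "S \<in> R" unfolding S_def by (intro R_sum R_mult R_power R_of_nat \<eta> R_hom assms(4))
  moreover have "\<phi> (of_nat ?p) \<in> PR" using residue_char_dvd_iff[of ?p] by (intro PR_hom) simp
  ultimately have "S * of_nat ?p \<in> PR" using PR_mult by simp
  have "\<phi> \<alpha> = (\<eta> + \<phi> a) ^ q"
    using \<beta> by (simp add: assms(1,2) power_mult[symmetric] mult.commute)
  also have "\<dots> = \<eta> ^ q + \<phi> a ^ q + \<eta> * (of_nat ?p * S)"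
    unfolding S_def by (rule binomial_prime_power[OF prime_residue_char assms(3)])
  finally have "\<eta> ^ q = - (\<eta> * (S * of_nat ?p)) - \<phi> (a ^ q - \<alpha>)"
    by (simp add: hom_minus hom_power algebra_simps)
  then show ?thesis using \<open>S * of_nat ?p \<in> PR\<close> by blast
qed

text \<open>The relation \<open>\<beta> ^ n = \<alpha>\<close> is used with
  \<open>\<eta> = \<beta>\<close>, \<open>q = n\<close>, \<open>G = 0\<close> and
  \<open>c = - \<alpha>\<close>.\<close>

lemma maximal_imp_not_mem_square:
  assumes max: "integers_of (adjoin_field \<phi> \<beta>) = R"
  shows "\<alpha> \<notin> ideal_square P"
proof
  assume "\<alpha> \<in> ideal_square P"
  then have "- \<alpha> \<in> ideal_square P" unfolding square_iff using idP(6)[of \<alpha>] idP(6)[of "\<gamma> * \<alpha>"] by simp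
  moreover have "\<beta> ^ n = - (\<beta> * 0) - \<phi> (- \<alpha>)" using \<beta> by (simp add: hom_uminus)
  moreover have "\<beta> ^ (n - 1) = ev (Polynomial.monom 1 (n - 1))" by simp
  moreover have "Polynomial.lead_coeff (Polynomial.monom (1::'l) (n - 1)) = 1" "Polynomial.degree (Polynomial.monom (1::'l) (n - 1)) < n"
    using n by (simp_all add: degree_monom_eq)
  ultimately show False
    using not_maximal_at_prime[OF R_root _ n PR_zero] max by metis
qed

lemma maximal_imp_not_congruent:
  assumes max: "integers_of (adjoin_field \<phi> \<beta>) = R"
    and e: "n = residue_char P ^ e * m" "e > 0" and s: "s \<ge> e"
  shows "\<alpha> ^ (residue_char P ^ s) - \<alpha> \<notin> ideal_square P"
proof
  let ?p = "residue_char P"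
  define q where "q = ?p ^ e"
  \<comment> \<open>A power of \<open>\<alpha>\<close> chosen so that
    \<open>a ^ q = \<alpha> ^ (p ^ s)\<close>; the constant \<open>c\<close> of the relation is then
    the difference in the congruence.\<close>
  define a where "a = \<alpha> ^ (?p ^ (s - e))"
  define \<eta> where "\<eta> = \<beta> ^ m - \<phi> a"
  have a: "algebraic_int a" unfolding a_def by (rule algebraic_int_power[OF \<alpha>])
  have "a ^ q = \<alpha> ^ (?p ^ s)"
    using s unfolding a_def q_def by (simp add: power_mult[symmetric] power_add[symmetric])
  moreover assume "\<alpha> ^ (?p ^ s) - \<alpha> \<in> ideal_square P"
  ultimately have c: "a ^ q - \<alpha> \<in> ideal_square P" by simp
  obtain G where G: "G \<in> PR" "\<eta> ^ q = - (\<eta> * G) - \<phi> (a ^ q - \<alpha>)"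
    using root_power_relation[OF \<eta>_def _ q_def a] e(1) by (auto simp: q_def)
  have \<eta>: "\<eta> \<in> R" unfolding \<eta>_def by (intro R_diff R_power R_root R_hom a)
  have m: "m > 0" using e(1) n by (cases m) auto
  have "?p \<le> ?p ^ e" using e(2) prime_gt_0_nat[OF prime_residue_char] by (intro self_le_power) auto
  then have q: "q \<ge> 2" unfolding q_def using prime_ge_2_nat[OF prime_residue_char] by simp
  define h where "h = Polynomial.monom 1 m - [:a:]"
  have h: "Polynomial.degree h = m" "Polynomial.lead_coeff h = 1"
  proof -
    have "Polynomial.degree h \<le> m" unfolding h_def by (intro degree_diff_le) (auto simp: degree_monom_le)
    moreover have "Polynomial.coeff h m = 1" unfolding h_def using m by (cases m) simp_all
    ultimately show "Polynomial.degree h = m" "Polynomial.lead_coeff h = 1"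
      using le_degree[of h m] by (auto intro: antisym)
  qed
  have "\<eta> ^ (q - 1) = ev (h ^ (q - 1))" by (simp add: \<eta>_def h_def)
  moreover have "Polynomial.lead_coeff (h ^ (q - 1)) = 1" using h(2) by (simp add: lead_coeff_power)
  \<comment> \<open>The exponent \<open>q - 1\<close> keeps the degree at
    \<open>m * (q - 1)\<close>, below \<open>m * q = n\<close>, so the representation is the reduced
    one.\<close>
  moreover have "Polynomial.degree (h ^ (q - 1)) < n"
  proof -
    have "Polynomial.degree (h ^ (q - 1)) = m * (q - 1)" using h m by (subst degree_power_eq) auto
    also have "\<dots> < m * q" using m q by simp
    finally show ?thesis using e(1) by (simp add: q_def mult.commute)
  qed
  ultimately show False
    using not_maximal_at_prime[OF \<eta> G(2) q G(1) c] max by blast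
qed

text \<open>If \<open>\<alpha>\<close> lies in \<open>P\<close>, the relation
  \<open>\<beta> ^ n = \<alpha>\<close> is of Eisenstein type. Otherwise
  \<open>\<eta> = \<beta> ^ m - a\<close> is used, where \<open>a\<close> is a root of
  \<open>\<alpha>\<close> of order \<open>p ^ e\<close> modulo \<open>P\<close>.\<close>

lemma maximal_at_prime_if:
  assumes sq: "\<alpha> \<notin> ideal_square P"
    and cong: "\<And>e m s. n = residue_char P ^ e * m \<Longrightarrow> e > 0 \<Longrightarrow> coprime m (residue_char P) \<Longrightarrow> s \<ge> e \<Longrightarrow>
      s < e + residue_degree P \<Longrightarrow> residue_degree P dvd s \<Longrightarrow> \<alpha> ^ (residue_char P ^ s) - \<alpha> \<notin> ideal_square P"
    and x: "x \<in> R" "algebraic_int (\<phi> \<gamma> * x)"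
  shows "x \<in> PR"
proof (cases "\<alpha> \<in> P")
  case True
  obtain r where "r \<ge> 2" "\<forall>u\<in>R. u ^ r - u \<in> J \<beta>" using frobenius_exists_root by blast
  moreover have "- \<alpha> \<in> P" using idP(6)[OF True] .
  moreover have "- \<alpha> \<notin> ideal_square P"
    using sq unfolding square_iff using idP(6)[of "- \<alpha>"] idP(6)[of "\<gamma> * - \<alpha>"] by auto
  moreover have "\<beta> ^ n = - (\<beta> * 0) - \<phi> (- \<alpha>)" using \<beta> by (simp add: hom_uminus)
  ultimately show ?thesis using maximal_at_prime[of r \<beta> n 0 "- \<alpha>"] R_root PR_zero x by blast
next
  case False
  let ?p = "residue_char P"
  define e where "e = multiplicity ?p n"
  obtain m where m: "n = ?p ^ e * m" "\<not> ?p dvd m"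
    unfolding e_def using multiplicity_decompose'[of n ?p] n prime_residue_char
    by (metis not_numeral_le_zero not_prime_unit)
  have m0: "m > 0" using m(1) n by (cases m) auto
  have cop: "coprime m ?p"
    using prime_imp_coprime[OF prime_residue_char m(2)] by (simp add: coprime_commute)
  let ?f = "residue_degree P"
  \<comment> \<open>The least multiple of \<open>f\<close> that is at least \<open>e\<close>, equal
    to \<open>f - \<epsilon> + e\<close>.\<close>
  define s where "s = ?f * ((e + ?f - 1) div ?f)"
  have s: "s \<ge> e" "s < e + ?f" "?f dvd s"
  proof -
    have "s + (e + ?f - 1) mod ?f = e + ?f - 1" unfolding s_def by simp
    moreover have "(e + ?f - 1) mod ?f < ?f" using residue_degree_pos by simp
    ultimately show "s \<ge> e" "s < e + ?f" using residue_degree_pos by linarith+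
    show "?f dvd s" by (simp add: s_def)
  qed
  define a where "a = \<alpha> ^ (?p ^ (s - e))"
  have a: "algebraic_int a" unfolding a_def by (rule algebraic_int_power[OF \<alpha>])
  have aP: "a \<notin> P" unfolding a_def using False prime_power_mem[OF P(1) \<alpha>] by blast
  have aq: "a ^ (?p ^ e) = \<alpha> ^ (?p ^ s)"
    using s(1) unfolding a_def by (simp add: power_mult[symmetric] power_add[symmetric])
  define \<eta> where "\<eta> = \<beta> ^ m - \<phi> a"
  have \<eta>: "\<eta> \<in> R" unfolding \<eta>_def by (intro R_diff R_power R_root R_hom a)
  obtain r where r: "r \<ge> 2" "\<And>u. u \<in> R \<Longrightarrow> u ^ r - u \<in> J \<eta>"
    using frobenius_exists[OF a aP m0 cop] unfolding \<eta>_def by blast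
  show ?thesis
  proof (cases "e = 0")
    case True
    \<comment> \<open>With \<open>e = 0\<close> also \<open>a = \<alpha>\<close> and
      \<open>m = n\<close>, so \<open>\<eta>\<close> vanishes and the reduced quotient is
      \<open>R / PR\<close>.\<close>
    then have "s = 0" using s by (metis dvd_imp_le less_add_same_cancel2 not_less plus_nat.add_0 gr_zeroI)
    then have "\<eta> = 0" unfolding \<eta>_def a_def using \<beta> m(1) True by simp
    then show ?thesis using maximal_at_prime_unramified[OF _ r(1) x] r(2) by blast
  next
    case False
    obtain G where G: "G \<in> PR" "\<eta> ^ (?p ^ e) = - (\<eta> * G) - \<phi> (\<alpha> ^ (?p ^ s) - \<alpha>)"
      using root_power_relation[OF \<eta>_def m(1) refl a] unfolding aq by blast
    have "\<alpha> ^ (?p ^ s) - \<alpha> \<in> P" using fermat[OF \<alpha> s(3)] .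
    moreover have "\<alpha> ^ (?p ^ s) - \<alpha> \<notin> ideal_square P" using cong[OF m(1) _ cop s(1,2,3)] False by simp
    ultimately show ?thesis using maximal_at_prime[OF r(2,1) \<eta> G(2,1)] x by blast
  qed
qed

end

section \<open>From local maximality to the full ring of integers\<close>

context radical_extension
begin

lemma R_subset_integers: "R \<subseteq> integers_of (adjoin_field \<phi> \<beta>)"
  using R_subset_adjoin_field R_algebraic_int by (auto simp: integers_of_def)

text \<open>For an integral \<open>y\<close> outside \<open>R\<close>, the denominators of
  \<open>y\<close> form a proper nonzero ideal with a prime colon ideal \<open>P\<close>. For
  \<open>z = b y\<close>, \<open>P\<close> is exactly the set of denominators of \<open>z\<close>.
  Local maximality applied to \<open>t z\<close> makes \<open>\<gamma> t\<close> a denominator of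
  \<open>z\<close>, hence an element of \<open>P\<close>, although it is 1 modulo
  \<open>P\<close>.\<close>

lemma maximal_if_maximal_at_primes:
  assumes local_max: "\<And>P \<gamma> t x. radical_at_prime \<alpha> \<phi> \<beta> n P \<gamma> t \<Longrightarrow> x \<in> R \<Longrightarrow>
    algebraic_int (\<phi> \<gamma> * x) \<Longrightarrow> \<phi> \<gamma> * x \<in> R"
  shows "integers_of (adjoin_field \<phi> \<beta>) = R"
proof (rule antisym)
  show "integers_of (adjoin_field \<phi> \<beta>) \<subseteq> R"
  proof (rule ccontr)
    assume "\<not> ?thesis"
    then obtain y where y: "y \<in> adjoin_field \<phi> \<beta>" "algebraic_int y" "y \<notin> R"
      by (auto simp: integers_of_def)
    define I where "I = {a. algebraic_int a \<and> \<phi> a * y \<in> R}"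
    have I: "ideal I ring_of_integers"
      unfolding ideal_integers_iff I_def
      by (simp add: R_zero R_add R_mult R_hom algebraic_int_add algebraic_int_mult hom_add hom_mult distrib_right mult.assoc)
    have "I \<noteq> {0}" using adjoin_field_denominator[OF y(1)] unfolding I_def by blast
    moreover have "1 \<notin> I" using y(3) by (simp add: I_def)
    ultimately obtain b where b: "algebraic_int b" "primeideal (colon I b) ring_of_integers"
      using prime_colon_exists[OF nf I, of "{1}"] by auto
    define P where "P = colon I b"
    have "prime_of_integers P"
      using b(2) colon_ideal(2)[OF I b(1)] \<open>I \<noteq> {0}\<close> ideal_integersD(2)[OF I]
      unfolding prime_of_integers_def P_def by blast
    then obtain \<gamma> t where \<gamma>t: "\<forall>a\<in>P. algebraic_int (\<gamma> * a)" "t \<in> P" "\<gamma> * t - 1 \<in> P"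
      using prime_inverse_exists[OF nf] by blast
    then interpret radical_at_prime \<alpha> \<phi> \<beta> n P \<gamma> t
      using nf \<open>prime_of_integers P\<close> by unfold_locales auto
    define z where "z = \<phi> b * y"
    have memP: "a \<in> P \<longleftrightarrow> algebraic_int a \<and> \<phi> a * z \<in> R" for a
      using b(1) by (auto simp: P_def colon_def I_def z_def hom_mult mult.assoc algebraic_int_mult)
    have "\<phi> t * z \<in> R" using memP t_mem by blast
    have alg: "algebraic_int (\<gamma> * t)" using inverse_mult[OF t_mem] .
    have "algebraic_int (\<phi> (\<gamma> * t) * z)"
      unfolding z_def
      by (rule algebraic_int_mult[OF algebraic_int_hom[OF alg]
            algebraic_int_mult[OF algebraic_int_hom[OF b(1)] y(2)]])
    then have "algebraic_int (\<phi> \<gamma> * (\<phi> t * z))" by (simp add: hom_mult mult.assoc)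
    then have "\<phi> \<gamma> * (\<phi> t * z) \<in> R"
      using local_max[OF radical_at_prime_axioms] \<open>\<phi> t * z \<in> R\<close> by blast
    then have "\<gamma> * t \<in> P" unfolding memP using alg by (simp add: hom_mult mult.assoc)
    then have "\<gamma> * t - (\<gamma> * t - 1) \<in> P" using idP(7) inverse_mult_t by blast
    then show False using P(4) by simp
  qed
qed (rule R_subset_integers)

end

theorem theorem6p1:
  fixes \<alpha> :: "'l::field_char_0"
    and \<phi> :: "'l \<Rightarrow> 'k::field_char_0"
    and \<beta> :: 'k
    and n :: nat
  assumes "number_field TYPE('l)"
    and "n \<ge> 2"
    and "\<alpha> \<in> integers_of UNIV"
    and "Factorial_Ring.irreducible (Polynomial.monom 1 n - [:\<alpha>:])"
    and "\<phi> \<in> ring_hom ring_of_type_algebra ring_of_type_algebra"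
    and "\<beta> ^ n = \<phi> \<alpha>"
  shows "integers_of (adjoin_field \<phi> \<beta>) = adjoin_integers \<phi> \<beta> \<longleftrightarrow>
    squarefree_as_ideal \<alpha> \<and>
    (\<forall>P :: 'l set. prime_of_integers P \<and> ideal_divides P (PIdl\<^bsub>ring_of_integers\<^esub> (of_nat n)) \<longrightarrow>
      (\<forall>p f e m \<epsilon> :: nat.
         p = residue_char P \<and> f = residue_degree P \<and>
         n = p ^ e * m \<and> coprime m p \<and>
         [\<epsilon> = e] (mod f) \<and> 1 \<le> \<epsilon> \<and> \<epsilon> \<le> f \<longrightarrow>
         \<not> \<alpha> ^ (p ^ (f - \<epsilon> + e)) - \<alpha> \<in> ideal_square P))"
proof -
  interpret radical_extension \<alpha> \<phi> \<beta> n using assms by unfold_locales simp_all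
  have at_prime: "\<exists>\<gamma> t. radical_at_prime \<alpha> \<phi> \<beta> n P \<gamma> t" if P: "prime_of_integers P" for P
  proof -
    obtain \<gamma> t where "\<forall>a\<in>P. algebraic_int (\<gamma> * a)" "t \<in> P" "\<gamma> * t - 1 \<in> P"
      using prime_inverse_exists[OF nf P] by blast
    then have "radical_at_prime \<alpha> \<phi> \<beta> n P \<gamma> t" using nf P by unfold_locales auto
    then show ?thesis by blast
  qed
  show ?thesis
  proof
    assume "integers_of (adjoin_field \<phi> \<beta>) = adjoin_integers \<phi> \<beta>"
    then have max: "integers_of (adjoin_field \<phi> \<beta>) = R" by (simp add: R_def)
    show "squarefree_as_ideal \<alpha> \<and>
      (\<forall>P :: 'l set. prime_of_integers P \<and> ideal_divides P (PIdl\<^bsub>ring_of_integers\<^esub> (of_nat n)) \<longrightarrow>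
      (\<forall>p f e m \<epsilon> :: nat.
         p = residue_char P \<and> f = residue_degree P \<and>
         n = p ^ e * m \<and> coprime m p \<and>
         [\<epsilon> = e] (mod f) \<and> 1 \<le> \<epsilon> \<and> \<epsilon> \<le> f \<longrightarrow>
         \<not> \<alpha> ^ (p ^ (f - \<epsilon> + e)) - \<alpha> \<in> ideal_square P))"
    proof (intro conjI allI impI; (elim conjE)?)
      show "squarefree_as_ideal \<alpha>"
        unfolding squarefree_as_ideal_def
      proof (intro allI impI)
        fix P :: "'l set" assume "prime_of_integers P"
        then obtain \<gamma> t where "radical_at_prime \<alpha> \<phi> \<beta> n P \<gamma> t" using at_prime by blast
        then interpret radical_at_prime \<alpha> \<phi> \<beta> n P \<gamma> t .
        show "\<not> ideal_divides (ideal_square P) (PIdl\<^bsub>ring_of_integers\<^esub> \<alpha>)"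
          using maximal_imp_not_mem_square[OF max] ideal_divides_principal_iff(2)[OF \<alpha>] by blast
      qed
    next
      fix P :: "'l set" and p f e m \<epsilon> :: nat
      assume prime: "prime_of_integers P" and dvd: "ideal_divides P (PIdl\<^bsub>ring_of_integers\<^esub> (of_nat n))"
        and *: "p = residue_char P" "f = residue_degree P" "n = p ^ e * m" "coprime m p" "\<epsilon> \<le> f"
      obtain \<gamma> t where "radical_at_prime \<alpha> \<phi> \<beta> n P \<gamma> t" using at_prime[OF prime] by blast
      then interpret radical_at_prime \<alpha> \<phi> \<beta> n P \<gamma> t .
      have "of_nat n \<in> P" using dvd ideal_divides_principal_iff(1) by simp
      then have "p dvd n" using residue_char_dvd_iff *(1) by simp
      \<comment> \<open>The prime \<open>p\<close> divides \<open>n\<close> because \<open>n\<close>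
        is in \<open>P\<close>, but it does not divide \<open>m\<close>.\<close>
      have "e > 0"
      proof (rule ccontr)
        assume "\<not> e > 0"
        then have "p dvd m" using \<open>p dvd n\<close> *(3) by simp
        then have "p dvd 1" using *(4) by (metis coprime_def dvd_refl)
        then show False using prime_residue_char *(1) by (metis not_prime_unit)
      qed
      then show "\<alpha> ^ (p ^ (f - \<epsilon> + e)) - \<alpha> \<notin> ideal_square P"
        using maximal_imp_not_congruent[OF max] * by auto
    qed
  next
    assume rhs: "squarefree_as_ideal \<alpha> \<and>
      (\<forall>P :: 'l set. prime_of_integers P \<and> ideal_divides P (PIdl\<^bsub>ring_of_integers\<^esub> (of_nat n)) \<longrightarrow>
      (\<forall>p f e m \<epsilon> :: nat.
         p = residue_char P \<and> f = residue_degree P \<and>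
         n = p ^ e * m \<and> coprime m p \<and>
         [\<epsilon> = e] (mod f) \<and> 1 \<le> \<epsilon> \<and> \<epsilon> \<le> f \<longrightarrow>
         \<not> \<alpha> ^ (p ^ (f - \<epsilon> + e)) - \<alpha> \<in> ideal_square P))"
    have "integers_of (adjoin_field \<phi> \<beta>) = R"
    proof (rule maximal_if_maximal_at_primes)
      fix P \<gamma> t x
      assume "radical_at_prime \<alpha> \<phi> \<beta> n P \<gamma> t" and x: "x \<in> R" "algebraic_int (\<phi> \<gamma> * x)"
      then interpret radical_at_prime \<alpha> \<phi> \<beta> n P \<gamma> t by simp
      have "\<alpha> \<notin> ideal_square P"
        using rhs prime ideal_divides_principal_iff(2)[OF \<alpha>] unfolding squarefree_as_ideal_def by blast
      moreover have "\<alpha> ^ (residue_char P ^ s) - \<alpha> \<notin> ideal_square P"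
        if n: "n = residue_char P ^ e * m" "e > 0" "coprime m (residue_char P)"
          and s: "s \<ge> e" "s < e + residue_degree P" "residue_degree P dvd s" for e m s
      proof -
        have "of_nat n \<in> P" using n residue_char_dvd_iff[of n] by simp
        then have dvd: "ideal_divides P (PIdl\<^bsub>ring_of_integers\<^esub> (of_nat n))"
          using ideal_divides_principal_iff(1) by simp
        \<comment> \<open>This solves \<open>s = f - \<epsilon> + e\<close>; the bounds on
          \<open>s\<close> give \<open>1 \<le> \<epsilon> \<le> f\<close>, and \<open>f\<close>
          dividing \<open>s\<close> gives the congruence with \<open>e\<close>.\<close>
        define \<epsilon> where "\<epsilon> = e + residue_degree P - s"
        have \<epsilon>: "1 \<le> \<epsilon>" "\<epsilon> \<le> residue_degree P" "residue_degree P - \<epsilon> + e = s"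
          using s by (simp_all add: \<epsilon>_def)
        have "[\<epsilon> + s = e + residue_degree P] (mod residue_degree P)" using s by (simp add: \<epsilon>_def)
        then have "[\<epsilon> = e] (mod residue_degree P)"
          using s(3) by (auto simp: cong_def elim!: dvdE)
        then show ?thesis using rhs prime dvd n \<epsilon> by metis
      qed
      ultimately have "x \<in> PR" using maximal_at_prime_if x by blast
      then show "\<phi> \<gamma> * x \<in> R" by (simp add: PR_def)
    qed
    then show "integers_of (adjoin_field \<phi> \<beta>) = adjoin_integers \<phi> \<beta>" by (simp add: R_def)
  qed
qed

end
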